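(* Let $X$ be a paracompact space and let $G\leq\mathcal{H}(X)$ be a bounded, factorizable and non-fixing group. Then the commutator subgroup $[G,G]$ is uniformly perfect.
   Context: Paracompact spaces are understood to be Hausdorff. $\mathcal{H}(X)$ is the group of all homeomorphisms of $X$. For $g\in\mathcal{H}(X)$, $\mathrm{supp}(g)$ is the closure of $\{x\in X: g(x)\neq x\}$. $G$ is factorizable if for every open cover $\mathcal{U}$ of $X$ and every $g\in G$ there are $g_1,\ldots,g_r\in G$ and $U_1,\ldots,U_r\in\mathcal{U}$ with $g=g_1\cdots g_r$ and $\mathrm{supp}(g_i)\subset U_i$ for all $i$. $G$ is non-fixing if for every $x\in X$ the orbit $\{g(x):g\in G\}$ is different from $\{x\}$. A conjugation-invariant norm on a group $G$ is a function $\nu:G\to[0,\infty)$ such that for all $g,h\in G$: $\nu(g)>0$ if and only if $g\neq e$; $\nu(g^{-1})=\nu(g)$; $\nu(gh)\le\nu(g)+\nu(h)$; $\nu(hgh^{-1})=\nu(g)$. A group is bounded if it is bounded with respect to any bi-invariant metric; equivalently, every conjugation-invariant norm on it is bounded. $[f,g]=fgf^{-1}g^{-1}$ and $[G,G]$ is the commutator subgroup. A group $H$ is uniformly perfect if $H=[H,H]$ and there is a positive integer $r$ such that every element of $H$ is a product of at most $r$ commutators of elements of $H$. *)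

theory Defs
  imports "HOL-Analysis.Analysis" "HOL-Algebra.Bij" "HOL-Algebra.Generated_Groups"
begin

definition open_cover :: "'a topology \<Rightarrow> 'a set set \<Rightarrow> bool" where
  "open_cover X \<U> \<longleftrightarrow> (\<forall>U\<in>\<U>. openin X U) \<and> \<Union>\<U> = topspace X"

definition paracompact_space :: "'a topology \<Rightarrow> bool" where
  "paracompact_space X \<longleftrightarrow> Hausdorff_space X \<and>
     (\<forall>\<U>. open_cover X \<U> \<longrightarrow>
        (\<exists>\<V>. open_cover X \<V> \<and> (\<forall>V\<in>\<V>. \<exists>U\<in>\<U>. V \<subseteq> U) \<and> locally_finite_in X \<V>))"

text \<open>As in \<^const>\<open>BijGroup\<close>, homeomorphisms are represented by extensional functions, so
  that maps agreeing on \<^term>\<open>topspace X\<close> are equal. The product of \<open>g\<close> and \<open>f\<close> is \<open>g\<close> after \<open>f\<close>.\<close>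

definition homeo_group :: "'a topology \<Rightarrow> ('a \<Rightarrow> 'a) monoid" where
  "homeo_group X = BijGroup (topspace X)
     \<lparr>carrier := {f \<in> extensional (topspace X). homeomorphic_map X X f}\<rparr>"

definition homeo_supp :: "'a topology \<Rightarrow> ('a \<Rightarrow> 'a) \<Rightarrow> 'a set" where
  "homeo_supp X g = X closure_of {x \<in> topspace X. g x \<noteq> x}"

definition list_product :: "('g, 'm) monoid_scheme \<Rightarrow> 'g list \<Rightarrow> 'g" where
  "list_product H gs = foldr (\<otimes>\<^bsub>H\<^esub>) gs \<one>\<^bsub>H\<^esub>"

definition factorizable :: "'a topology \<Rightarrow> ('a \<Rightarrow> 'a) set \<Rightarrow> bool" where
  "factorizable X G \<longleftrightarrow>
     (\<forall>\<U>. open_cover X \<U> \<longrightarrow>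
        (\<forall>g\<in>G. \<exists>gs. set gs \<subseteq> G \<and> g = list_product (homeo_group X) gs \<and>
                    (\<forall>h\<in>set gs. \<exists>U\<in>\<U>. homeo_supp X h \<subseteq> U)))"

definition non_fixing :: "'a topology \<Rightarrow> ('a \<Rightarrow> 'a) set \<Rightarrow> bool" where
  "non_fixing X G \<longleftrightarrow> (\<forall>x\<in>topspace X. {g x | g. g \<in> G} \<noteq> {x})"

definition bi_invariant_metric :: "('g, 'm) monoid_scheme \<Rightarrow> ('g \<Rightarrow> 'g \<Rightarrow> real) \<Rightarrow> bool" where
  "bi_invariant_metric H d \<longleftrightarrow> Metric_space (carrier H) d \<and>
     (\<forall>g\<in>carrier H. \<forall>h\<in>carrier H. \<forall>k\<in>carrier H.
        d (k \<otimes>\<^bsub>H\<^esub> g) (k \<otimes>\<^bsub>H\<^esub> h) = d g h \<and> d (g \<otimes>\<^bsub>H\<^esub> k) (h \<otimes>\<^bsub>H\<^esub> k) = d g h)"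

definition bounded_group :: "('g, 'm) monoid_scheme \<Rightarrow> bool" where
  "bounded_group H \<longleftrightarrow>
     (\<forall>d. bi_invariant_metric H d \<longrightarrow> Metric_space.mbounded (carrier H) d (carrier H))"

definition conj_invariant_norm :: "('g, 'm) monoid_scheme \<Rightarrow> ('g \<Rightarrow> real) \<Rightarrow> bool" where
  "conj_invariant_norm H \<nu> \<longleftrightarrow>
     (\<forall>g\<in>carrier H. 0 \<le> \<nu> g) \<and>
     (\<forall>g\<in>carrier H. \<nu> g > 0 \<longleftrightarrow> g \<noteq> \<one>\<^bsub>H\<^esub>) \<and>
     (\<forall>g\<in>carrier H. \<nu> (inv\<^bsub>H\<^esub> g) = \<nu> g) \<and>
     (\<forall>g\<in>carrier H. \<forall>h\<in>carrier H. \<nu> (g \<otimes>\<^bsub>H\<^esub> h) \<le> \<nu> g + \<nu> h) \<and>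
     (\<forall>g\<in>carrier H. \<forall>h\<in>carrier H. \<nu> (h \<otimes>\<^bsub>H\<^esub> g \<otimes>\<^bsub>H\<^esub> inv\<^bsub>H\<^esub> h) = \<nu> g)"

definition uniformly_perfect :: "('g, 'm) monoid_scheme \<Rightarrow> bool" where
  "uniformly_perfect H \<longleftrightarrow>
     carrier H = derived H (carrier H) \<and>
     (\<exists>r>0. \<forall>h\<in>carrier H. \<exists>cs. length cs \<le> r \<and>
        set cs \<subseteq> derived_set H (carrier H) \<and> h = list_product H cs)"

lemma subgroup_homeo_BijGroup:
  "subgroup {f \<in> extensional (topspace X). homeomorphic_map X X f} (BijGroup (topspace X))"
proof -
  let ?S = "topspace X"
  let ?H = "{f \<in> extensional ?S. homeomorphic_map X X f}"
  interpret B: group "BijGroup ?S" by (rule group_BijGroup)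
  have sub: "?H \<subseteq> Bij ?S"
    using homeomorphic_imp_injective_map homeomorphic_imp_surjective_map by (fastforce simp: Bij_def bij_betw_def)
  have inv_mem: "inv\<^bsub>BijGroup ?S\<^esub> f \<in> ?H" if f: "f \<in> ?H" for f
  proof -
    have fB: "f \<in> Bij ?S" using f sub by blast
    let ?g = "\<lambda>x\<in>?S. inv_into ?S f x"
    have "?g \<otimes>\<^bsub>BijGroup ?S\<^esub> f = \<one>\<^bsub>BijGroup ?S\<^esub>"
      using fB by (simp add: BijGroup_def restrict_inv_into_Bij Bij_compose_restrict_eq)
    then have eq: "inv\<^bsub>BijGroup ?S\<^esub> f = ?g"
      using fB restrict_inv_into_Bij[OF fB] by (intro B.inv_equality) (auto simp: BijGroup_def)
    from f obtain g where g: "homeomorphic_maps X X f g"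
      by (auto simp: homeomorphic_map_maps)
    then have gh: "homeomorphic_map X X g"
      using homeomorphic_maps_map by blast
    have "g x = ?g x" if "x \<in> ?S" for x
    proof -
      have "g x \<in> ?S" using gh that homeomorphic_imp_surjective_map by blast
      moreover have "f (g x) = x" using g that by (auto simp: homeomorphic_maps_def)
      moreover have "inj_on f ?S" using f homeomorphic_imp_injective_map by blast
      ultimately have "inv_into ?S f x = g x" by (metis inv_into_f_f)
      with that show ?thesis by simp
    qed
    then have "homeomorphic_map X X ?g" using homeomorphic_map_eq[OF gh] by blast
    then show ?thesis unfolding eq by auto
  qed
  have mult_mem: "f \<otimes>\<^bsub>BijGroup ?S\<^esub> g \<in> ?H" if f: "f \<in> ?H" and g: "g \<in> ?H" for f g
  proof -
    have "homeomorphic_map X X (f \<circ> g)"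
      using f g homeomorphic_map_compose by blast
    then have "homeomorphic_map X X (compose ?S f g)"
      by (rule homeomorphic_map_eq) (simp add: compose_def)
    moreover have "f \<in> Bij ?S" "g \<in> Bij ?S" using f g sub by auto
    ultimately show ?thesis
      by (simp add: BijGroup_def compose_def)
  qed
  have one_mem: "\<one>\<^bsub>BijGroup ?S\<^esub> \<in> ?H"
  proof -
    have "homeomorphic_map X X (\<lambda>x\<in>?S. x)"
      by (rule homeomorphic_map_eq[of X X id]) auto
    then show ?thesis by (simp add: BijGroup_def)
  qed
  show ?thesis
    by (rule subgroup.intro) (use sub mult_mem one_mem inv_mem in \<open>auto simp: BijGroup_def\<close>)
qed

lemma group_homeo_group: "group (homeo_group X)"
  unfolding homeo_group_def
  by (rule subgroup.subgroup_is_group[OF subgroup_homeo_BijGroup group_BijGroup])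

lemma bounded_group_iff_conj_invariant_norm:
  assumes "group H"
  shows "bounded_group H \<longleftrightarrow> (\<forall>\<nu>. conj_invariant_norm H \<nu> \<longrightarrow> (\<exists>B. \<forall>g\<in>carrier H. \<nu> g \<le> B))"
proof -
  interpret group H by (rule assms)
  show ?thesis
  proof (intro iffI allI impI)
    fix \<nu> assume b: "bounded_group H" and n: "conj_invariant_norm H \<nu>"
    define d where "d g h = (if g \<in> carrier H \<and> h \<in> carrier H then \<nu> (g \<otimes>\<^bsub>H\<^esub> inv\<^bsub>H\<^esub> h) else 0)" for g h
    have nonneg: "0 \<le> \<nu> g" and pos: "\<nu> g > 0 \<longleftrightarrow> g \<noteq> \<one>\<^bsub>H\<^esub>" and ninv: "\<nu> (inv\<^bsub>H\<^esub> g) = \<nu> g"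
      if "g \<in> carrier H" for g
      using n that by (auto simp: conj_invariant_norm_def)
    have tri: "\<nu> (g \<otimes>\<^bsub>H\<^esub> h) \<le> \<nu> g + \<nu> h" and conj: "\<nu> (h \<otimes>\<^bsub>H\<^esub> g \<otimes>\<^bsub>H\<^esub> inv\<^bsub>H\<^esub> h) = \<nu> g"
      if "g \<in> carrier H" "h \<in> carrier H" for g h
      using n that by (auto simp: conj_invariant_norm_def)
    have M: "Metric_space (carrier H) d"
    proof
      show "0 \<le> d x y" for x y by (simp add: d_def nonneg)
      show "d x y = d y x" for x y
        using ninv[of "x \<otimes>\<^bsub>H\<^esub> inv\<^bsub>H\<^esub> y"] by (auto simp: d_def inv_mult_group)
      show "d x y = 0 \<longleftrightarrow> x = y" if "x \<in> carrier H" "y \<in> carrier H" for x y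
        using that pos[of "x \<otimes>\<^bsub>H\<^esub> inv\<^bsub>H\<^esub> y"] nonneg[of "x \<otimes>\<^bsub>H\<^esub> inv\<^bsub>H\<^esub> y"]
        by (auto simp: d_def less_le) (metis inv_equality inv_closed inv_inv)+
      show "d x z \<le> d x y + d y z" if "x \<in> carrier H" "y \<in> carrier H" "z \<in> carrier H" for x y z
      proof -
        have "x \<otimes>\<^bsub>H\<^esub> inv\<^bsub>H\<^esub> z = (x \<otimes>\<^bsub>H\<^esub> inv\<^bsub>H\<^esub> y) \<otimes>\<^bsub>H\<^esub> (y \<otimes>\<^bsub>H\<^esub> inv\<^bsub>H\<^esub> z)"
          using that by (simp add: m_assoc inv_solve_left)
        then show ?thesis
          using that tri[of "x \<otimes>\<^bsub>H\<^esub> inv\<^bsub>H\<^esub> y" "y \<otimes>\<^bsub>H\<^esub> inv\<^bsub>H\<^esub> z"] by (simp add: d_def)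
      qed
    qed
    have "bi_invariant_metric H d"
      unfolding bi_invariant_metric_def
    proof (intro conjI ballI M)
      fix g h k assume c: "g \<in> carrier H" "h \<in> carrier H" "k \<in> carrier H"
      have "(k \<otimes>\<^bsub>H\<^esub> g) \<otimes>\<^bsub>H\<^esub> inv\<^bsub>H\<^esub> (k \<otimes>\<^bsub>H\<^esub> h) = k \<otimes>\<^bsub>H\<^esub> (g \<otimes>\<^bsub>H\<^esub> inv\<^bsub>H\<^esub> h) \<otimes>\<^bsub>H\<^esub> inv\<^bsub>H\<^esub> k"
        using c by (simp add: inv_mult_group m_assoc)
      then show "d (k \<otimes>\<^bsub>H\<^esub> g) (k \<otimes>\<^bsub>H\<^esub> h) = d g h"
        using c conj[of "g \<otimes>\<^bsub>H\<^esub> inv\<^bsub>H\<^esub> h" k] by (simp add: d_def)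
      have "(g \<otimes>\<^bsub>H\<^esub> k) \<otimes>\<^bsub>H\<^esub> inv\<^bsub>H\<^esub> (h \<otimes>\<^bsub>H\<^esub> k) = g \<otimes>\<^bsub>H\<^esub> inv\<^bsub>H\<^esub> h"
      proof -
        have "k \<otimes>\<^bsub>H\<^esub> (inv\<^bsub>H\<^esub> k \<otimes>\<^bsub>H\<^esub> inv\<^bsub>H\<^esub> h) = inv\<^bsub>H\<^esub> h"
          using c by (simp add: m_assoc[symmetric])
        then show ?thesis using c by (simp add: inv_mult_group m_assoc)
      qed
      then show "d (g \<otimes>\<^bsub>H\<^esub> k) (h \<otimes>\<^bsub>H\<^esub> k) = d g h"
        using c by (simp add: d_def)
    qed
    then have "Metric_space.mbounded (carrier H) d (carrier H)"
      using b by (simp add: bounded_group_def)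
    then obtain B where B: "\<And>x y. x \<in> carrier H \<Longrightarrow> y \<in> carrier H \<Longrightarrow> d x y \<le> B"
      by (auto simp: Metric_space.mbounded_alt[OF M])
    show "\<exists>B. \<forall>g\<in>carrier H. \<nu> g \<le> B"
    proof (intro exI ballI)
      fix g assume "g \<in> carrier H"
      then show "\<nu> g \<le> B" using B[of g "\<one>\<^bsub>H\<^esub>"] by (simp add: d_def)
    qed
  next
    assume b: "\<forall>\<nu>. conj_invariant_norm H \<nu> \<longrightarrow> (\<exists>B. \<forall>g\<in>carrier H. \<nu> g \<le> B)"
    show "bounded_group H"
      unfolding bounded_group_def
    proof (intro allI impI)
      fix d assume d: "bi_invariant_metric H d"
      then interpret M: Metric_space "carrier H" d by (simp add: bi_invariant_metric_def)
      have l: "d (k \<otimes>\<^bsub>H\<^esub> g) (k \<otimes>\<^bsub>H\<^esub> h) = d g h" and r: "d (g \<otimes>\<^bsub>H\<^esub> k) (h \<otimes>\<^bsub>H\<^esub> k) = d g h"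
        if "g \<in> carrier H" "h \<in> carrier H" "k \<in> carrier H" for g h k
        using d that by (auto simp: bi_invariant_metric_def)
      have "conj_invariant_norm H (\<lambda>g. d g \<one>\<^bsub>H\<^esub>)"
        unfolding conj_invariant_norm_def
      proof (intro conjI ballI)
        fix g assume g: "g \<in> carrier H"
        show "0 \<le> d g \<one>\<^bsub>H\<^esub>" by simp
        show "0 < d g \<one>\<^bsub>H\<^esub> \<longleftrightarrow> g \<noteq> \<one>\<^bsub>H\<^esub>" using g by simp
        show "d (inv\<^bsub>H\<^esub> g) \<one>\<^bsub>H\<^esub> = d g \<one>\<^bsub>H\<^esub>"
          using g l[of "inv\<^bsub>H\<^esub> g" "\<one>\<^bsub>H\<^esub>" g] by (simp add: M.commute)
      next
        fix g h assume g: "g \<in> carrier H" and h: "h \<in> carrier H"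
        show "d (g \<otimes>\<^bsub>H\<^esub> h) \<one>\<^bsub>H\<^esub> \<le> d g \<one>\<^bsub>H\<^esub> + d h \<one>\<^bsub>H\<^esub>"
          using g h r[of g "\<one>\<^bsub>H\<^esub>" h] M.triangle[of "g \<otimes>\<^bsub>H\<^esub> h" h "\<one>\<^bsub>H\<^esub>"] by simp
        show "d (h \<otimes>\<^bsub>H\<^esub> g \<otimes>\<^bsub>H\<^esub> inv\<^bsub>H\<^esub> h) \<one>\<^bsub>H\<^esub> = d g \<one>\<^bsub>H\<^esub>"
          using g h r[of "h \<otimes>\<^bsub>H\<^esub> g" h "inv\<^bsub>H\<^esub> h"] l[of g "\<one>\<^bsub>H\<^esub>" h] by simp
      qed
      then obtain B where B: "\<And>g. g \<in> carrier H \<Longrightarrow> d g \<one>\<^bsub>H\<^esub> \<le> B" using b by blast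
      then show "M.mbounded (carrier H)"
        unfolding M.mbounded_def
        by (intro exI[of _ "\<one>\<^bsub>H\<^esub>"] exI[of _ B]) (auto simp: M.mcball_def M.commute)
    qed
  qed
qed

end

theory Submission
  imports Defs "HOL-Computational_Algebra.Primes"
begin

text \<open>Let \<open>H = [G, G]\<close>. A bounded abelian group is finite: an infinite one has a countably infinite
  quotient, which carries a weighted word norm with finite balls. Hence \<open>G/H\<close> is finite, and it
  follows that every element of \<open>H\<close> is a product of boundedly many commutators of elements of \<open>G\<close>.

  Finiteness of \<open>G/H\<close> also implies that \<open>G\<close> is generated by those \<open>r\<close> with displaceable
  support near some point \<open>p\<close> whose class modulo \<open>H\<close> is represented in every neighbourhood of \<open>p\<close>,
  and hence also near every point of the orbit of \<open>p\<close>. These generators form a conjugation-invariant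
  set, so by boundedness every element of \<open>G\<close> is a product of boundedly many of them. Given two
  generators, one can move their supports apart while changing them only by elements of \<open>H\<close> with
  displaceable support; this shows that their commutator is a product of three commutators of
  elements of \<open>H\<close>, however the original supports overlap.\<close>


section \<open>Bounded groups\<close>

context group
begin

lemma list_product_Nil [simp]: "list_product G [] = \<one>"
  by (simp add: list_product_def)

lemma list_product_Cons [simp]: "list_product G (x # xs) = x \<otimes> list_product G xs"
  by (simp add: list_product_def)

lemma list_product_closed [simp]: "set xs \<subseteq> carrier G \<Longrightarrow> list_product G xs \<in> carrier G"
  by (induction xs) auto

lemma list_product_append:
  "set xs \<subseteq> carrier G \<Longrightarrow> set ys \<subseteq> carrier G
    \<Longrightarrow> list_product G (xs @ ys) = list_product G xs \<otimes> list_product G ys"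
  by (induction xs) (auto simp: m_assoc)

lemma conj_mult:
  assumes "k \<in> carrier G" "x \<in> carrier G" "y \<in> carrier G"
  shows "k \<otimes> (x \<otimes> y) \<otimes> inv k = (k \<otimes> x \<otimes> inv k) \<otimes> (k \<otimes> y \<otimes> inv k)"
proof -
  have "inv k \<otimes> (k \<otimes> (y \<otimes> inv k)) = y \<otimes> inv k"
    using assms by (simp add: m_assoc[symmetric])
  then show ?thesis using assms by (simp add: m_assoc)
qed

lemma conj_inv:
  assumes "k \<in> carrier G" "x \<in> carrier G"
  shows "inv (k \<otimes> x \<otimes> inv k) = k \<otimes> inv x \<otimes> inv k"
  using assms by (simp add: inv_mult_group m_assoc)

lemma conj_conj_inv:
  assumes "k \<in> carrier G" "x \<in> carrier G"
  shows "inv k \<otimes> (k \<otimes> x \<otimes> inv k) \<otimes> k = x"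
  using assms by (simp add: m_assoc) (simp add: m_assoc[symmetric])

lemma conj_list_product:
  assumes "k \<in> carrier G" "set xs \<subseteq> carrier G"
  shows "k \<otimes> list_product G xs \<otimes> inv k = list_product G (map (\<lambda>x. k \<otimes> x \<otimes> inv k) xs)"
  using assms(2) by (induction xs) (simp_all add: assms(1) conj_mult)

text \<open>Adding the value at the inverse makes \<open>\<nu>\<close> symmetric, and a further 1
  away from the identity makes it positive there, so the result is a conjugation-invariant norm. An
  inequality under conjugation suffices, since conjugating back gives the reverse one. This is the
  form in which boundedness is applied to word lengths.\<close>

lemma bounded_group_nat_norm:
  fixes \<nu> :: "'a \<Rightarrow> nat"
  assumes bdd: "bounded_group G"
    and sub: "\<And>x y. x \<in> carrier G \<Longrightarrow> y \<in> carrier G \<Longrightarrow> \<nu> (x \<otimes> y) \<le> \<nu> x + \<nu> y"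
    and conj: "\<And>k x. k \<in> carrier G \<Longrightarrow> x \<in> carrier G \<Longrightarrow> \<nu> (k \<otimes> x \<otimes> inv k) \<le> \<nu> x"
  shows "\<exists>B. \<forall>x\<in>carrier G. \<nu> x \<le> B"
proof -
  define N where "N x = (if x = \<one> then 0 else real (\<nu> x + \<nu> (inv x) + 1))" for x
  have conj_eq: "\<nu> (k \<otimes> x \<otimes> inv k) = \<nu> x" if "k \<in> carrier G" "x \<in> carrier G" for k x
    using conj[of k x] conj[of "inv k" "k \<otimes> x \<otimes> inv k"] that by (simp add: conj_conj_inv)
  have "conj_invariant_norm G N"
    unfolding conj_invariant_norm_def
  proof (intro conjI ballI)
    fix g assume g: "g \<in> carrier G"
    show "0 \<le> N g" "0 < N g \<longleftrightarrow> g \<noteq> \<one>" by (auto simp: N_def)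
    show "N (inv g) = N g" using g by (auto simp: N_def inv_eq_1_iff)
  next
    fix g h assume g: "g \<in> carrier G" and h: "h \<in> carrier G"
    show "N (g \<otimes> h) \<le> N g + N h"
      using sub[OF g h] sub[of "inv h" "inv g"] g h by (auto simp: N_def inv_mult_group)
    have "h \<otimes> g \<otimes> inv h = \<one> \<longleftrightarrow> g = \<one>"
      using g h by (metis conj_conj_inv inv_closed l_inv r_one r_inv)
    then show "N (h \<otimes> g \<otimes> inv h) = N g"
      using g h by (simp add: N_def conj_eq conj_inv)
  qed
  then obtain B where B: "\<And>x. x \<in> carrier G \<Longrightarrow> N x \<le> B"
    using bdd bounded_group_iff_conj_invariant_norm[OF group_axioms] by blast
  \<comment> \<open>The norm \<open>N\<close> is set to 0 at the identity and so says nothing about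
    \<open>\<nu> \<one>\<close>, which enters the bound separately.\<close>
  have "\<nu> x \<le> max (\<nu> \<one>) (nat \<lceil>B\<rceil>)" if "x \<in> carrier G" for x
  proof (cases "x = \<one>")
    case False
    then have "real (\<nu> x) \<le> B" using B[OF that] by (simp add: N_def)
    then show ?thesis by linarith
  qed simp
  then show ?thesis by blast
qed

text \<open>The least total weight of a word for \<open>g\<close> is subadditive by concatenation
  and conjugation invariant by conjugating letter by letter. Since each letter weighs
  \<open>Suc (w y)\<close>, the bound controls both the length of the word and the weight of its
  letters. With \<open>w\<close> constantly 0 it is plain word length; with \<open>w\<close>
  injective only finitely many letters can occur.\<close>

lemma bounded_group_generation:
  fixes w :: "'a \<Rightarrow> nat"
  assumes bdd: "bounded_group G" and Y: "Y \<subseteq> carrier G"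
    and Y_conj: "\<And>k y. k \<in> carrier G \<Longrightarrow> y \<in> Y \<Longrightarrow> k \<otimes> y \<otimes> inv k \<in> Y"
    and w_conj: "\<And>k y. k \<in> carrier G \<Longrightarrow> y \<in> Y \<Longrightarrow> w (k \<otimes> y \<otimes> inv k) = w y"
    and gen: "\<And>g. g \<in> carrier G \<Longrightarrow> \<exists>ys. set ys \<subseteq> Y \<and> g = list_product G ys"
  shows "\<exists>N. \<forall>g\<in>carrier G. \<exists>ys. set ys \<subseteq> Y \<and> g = list_product G ys \<and> sum_list (map (Suc \<circ> w) ys) \<le> N"
proof -
  let ?P = "\<lambda>g n. \<exists>ys. set ys \<subseteq> Y \<and> g = list_product G ys \<and> sum_list (map (Suc \<circ> w) ys) = n"
  define \<nu> where "\<nu> g = (LEAST n. ?P g n)" for g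
  have ex: "?P g (\<nu> g)" if "g \<in> carrier G" for g
    unfolding \<nu>_def by (rule LeastI_ex) (use gen[OF that] in blast)
  have le: "\<nu> g \<le> n" if "?P g n" for g n
    unfolding \<nu>_def using that by (rule Least_le)
  have "\<exists>B. \<forall>g\<in>carrier G. \<nu> g \<le> B"
  proof (rule bounded_group_nat_norm[OF bdd])
    fix x y assume x: "x \<in> carrier G" and y: "y \<in> carrier G"
    obtain xs ys where "set xs \<subseteq> Y" "x = list_product G xs" "sum_list (map (Suc \<circ> w) xs) = \<nu> x"
      and "set ys \<subseteq> Y" "y = list_product G ys" "sum_list (map (Suc \<circ> w) ys) = \<nu> y"
      using ex[OF x] ex[OF y] by auto
    then show "\<nu> (x \<otimes> y) \<le> \<nu> x + \<nu> y"
      using Y by (intro le exI[of _ "xs @ ys"]) (auto simp: list_product_append)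
  next
    fix k x assume k: "k \<in> carrier G" and x: "x \<in> carrier G"
    obtain xs where xs: "set xs \<subseteq> Y" "x = list_product G xs" "sum_list (map (Suc \<circ> w) xs) = \<nu> x"
      using ex[OF x] by auto
    have "map (Suc \<circ> w) (map (\<lambda>x. k \<otimes> x \<otimes> inv k) xs) = map (Suc \<circ> w) xs"
      using xs(1) w_conj[OF k] by auto
    with xs k Y show "\<nu> (k \<otimes> x \<otimes> inv k) \<le> \<nu> x"
      by (intro le exI[of _ "map (\<lambda>x. k \<otimes> x \<otimes> inv k) xs"])
        (auto simp: conj_list_product Y_conj simp del: map_map)
  qed
  then obtain B where "\<And>g. g \<in> carrier G \<Longrightarrow> \<nu> g \<le> B" by blast
  then show ?thesis using ex by (intro exI[of _ B] ballI) fastforce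
qed

text \<open>A norm on the quotient pulls back to a function that is constant on cosets of
  \<open>N\<close>; adding 1 away from the identity turns it into a norm on the group, and a bound
  for that one bounds the original.\<close>

lemma bounded_group_FactGroup:
  assumes bdd: "bounded_group G" and N: "N \<lhd> G"
  shows "bounded_group (G Mod N)"
proof -
  interpret N: normal N G by (rule N)
  interpret Q: group "G Mod N" by (rule N.factorgroup_is_group)
  interpret h: group_hom G "G Mod N" "\<lambda>x. N #> x"
    by (unfold_locales, rule N.r_coset_hom_Mod)
  show ?thesis
    unfolding bounded_group_iff_conj_invariant_norm[OF Q.group_axioms]
  proof (intro allI impI)
    fix \<nu> assume "conj_invariant_norm (G Mod N) \<nu>"
    then have nonneg: "\<And>q. q \<in> carrier (G Mod N) \<Longrightarrow> 0 \<le> \<nu> q"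
      and inv: "\<And>q. q \<in> carrier (G Mod N) \<Longrightarrow> \<nu> (inv\<^bsub>G Mod N\<^esub> q) = \<nu> q"
      and sub: "\<And>q r. q \<in> carrier (G Mod N) \<Longrightarrow> r \<in> carrier (G Mod N)
        \<Longrightarrow> \<nu> (q \<otimes>\<^bsub>G Mod N\<^esub> r) \<le> \<nu> q + \<nu> r"
      and conj: "\<And>q r. q \<in> carrier (G Mod N) \<Longrightarrow> r \<in> carrier (G Mod N)
        \<Longrightarrow> \<nu> (r \<otimes>\<^bsub>G Mod N\<^esub> q \<otimes>\<^bsub>G Mod N\<^esub> inv\<^bsub>G Mod N\<^esub> r) = \<nu> q"
      unfolding conj_invariant_norm_def by blast+
    define f where "f x = (if x = \<one> then 0 else \<nu> (N #> x) + 1)" for x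
    have "conj_invariant_norm G f"
      unfolding conj_invariant_norm_def
    proof (intro conjI ballI)
      fix g assume g: "g \<in> carrier G"
      show "0 \<le> f g" "0 < f g \<longleftrightarrow> g \<noteq> \<one>" using nonneg[OF h.hom_closed[OF g]] by (auto simp: f_def)
      show "f (inv g) = f g"
        using inv[OF h.hom_closed[OF g]] g h.hom_inv[OF g] by (auto simp: f_def inv_eq_1_iff)
    next
      fix g k assume g: "g \<in> carrier G" and k: "k \<in> carrier G"
      show "f (g \<otimes> k) \<le> f g + f k"
        using sub[OF h.hom_closed[OF g] h.hom_closed[OF k]] h.hom_mult[OF g k] g k
          nonneg[OF h.hom_closed[OF g]] nonneg[OF h.hom_closed[OF k]]
        by (cases "g = \<one>"; cases "k = \<one>") (auto simp: f_def)
      have "k \<otimes> g \<otimes> inv k = \<one> \<longleftrightarrow> g = \<one>"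
        using g k by (metis conj_conj_inv inv_closed l_inv r_one r_inv)
      moreover have "N #> (k \<otimes> g \<otimes> inv k) = (N #> k) \<otimes>\<^bsub>G Mod N\<^esub> (N #> g) \<otimes>\<^bsub>G Mod N\<^esub> inv\<^bsub>G Mod N\<^esub> (N #> k)"
        using g k by (simp only: h.hom_mult h.hom_inv m_closed inv_closed)
      ultimately show "f (k \<otimes> g \<otimes> inv k) = f g"
        using conj[OF h.hom_closed[OF g] h.hom_closed[OF k]] by (simp only: f_def)
    qed
    then obtain B where B: "\<And>x. x \<in> carrier G \<Longrightarrow> f x \<le> B"
      using bdd bounded_group_iff_conj_invariant_norm[OF group_axioms] by blast
    have "\<nu> q \<le> max (\<nu> \<one>\<^bsub>G Mod N\<^esub>) B" if "q \<in> carrier (G Mod N)" for q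
    proof -
      obtain x where x: "x \<in> carrier G" "q = N #> x"
        using \<open>q \<in> carrier (G Mod N)\<close> by (auto simp: carrier_FactGroup)
      show ?thesis
        using B[OF x(1)] x(2) h.hom_one by (cases "x = \<one>") (auto simp: f_def)
    qed
    then show "\<exists>B. \<forall>q\<in>carrier (G Mod N). \<nu> q \<le> B" by blast
  qed
qed

end

section \<open>Bounded abelian groups are finite\<close>

context comm_group
begin

text \<open>Splitting a prime \<open>p\<close> off \<open>n = p * m\<close>, the \<open>n\<close>-th
  roots of \<open>Z\<close> are the \<open>p\<close>-th roots of its \<open>m\<close>-th roots. It
  therefore suffices that each \<open>p\<close>-th power map has countable fibres, which follows
  once the elements of order \<open>p\<close> are countably many.\<close>

lemma countable_torsion_roots:
  assumes D: "countable D" "D \<subseteq> carrier G"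
    and ess: "\<And>x. x \<in> carrier G \<Longrightarrow> x \<noteq> \<one> \<Longrightarrow> \<exists>n::nat. x [^] n \<in> D - {\<one>}"
    and n: "n > 0" and Z: "countable Z"
  shows "countable {x \<in> carrier G. x [^] (n::nat) \<in> Z}"
  using n Z
proof (induction n arbitrary: Z rule: less_induct)
  case (less n)
  show ?case
  proof (cases "n = 1")
    case True
    have "{x \<in> carrier G. x [^] n \<in> Z} \<subseteq> Z" by (auto simp: True)
    then show ?thesis using less.prems countable_subset by blast
  next
    case False
    then obtain p where p: "prime p" "p dvd n" using prime_factor_nat by blast
    then obtain m where m: "n = p * m" by auto
    have "m > 0" "m < n" using less.prems m prime_gt_1_nat[OF p(1)] by auto
    text \<open>If \<open>x\<close> has order \<open>p\<close>, then any nontrivial power of \<open>x\<close> generates the same subgroup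
      as \<open>x\<close>; one of these powers lies in \<open>D\<close>.\<close>
    have "{x \<in> carrier G. x [^] p = \<one>} \<subseteq> insert \<one> (\<Union>d\<in>D. range (\<lambda>j::nat. d [^] j))"
    proof
      fix x assume "x \<in> {x \<in> carrier G. x [^] p = \<one>}"
      then have x: "x \<in> carrier G" "x [^] p = \<one>" by auto
      show "x \<in> insert \<one> (\<Union>d\<in>D. range (\<lambda>j::nat. d [^] j))"
      proof (cases "x = \<one>")
        case False
        then obtain k :: nat where k: "x [^] k \<in> D" "x [^] k \<noteq> \<one>" using ess x by blast
        have "\<not> p dvd k" using k(2) x by (auto simp: nat_pow_pow[symmetric])
        then have "coprime k p" using p(1) prime_imp_coprime coprime_commute by blast
        moreover have "k \<noteq> 0" using k(2) by (metis nat_pow_0)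
        ultimately obtain u v where uv: "k * u = p * v + 1"
          using bezout_nat[of k p] by auto
        have "(x [^] k) [^] u = x"
          using x by (simp add: nat_pow_pow uv nat_pow_mult[symmetric]) (simp add: nat_pow_pow[symmetric])
        then show ?thesis using k(1) by (auto intro!: bexI[of _ "x [^] k"] exI[of _ u] simp: image_iff)
      qed simp
    qed
    then have tors: "countable {x \<in> carrier G. x [^] p = \<one>}"
      by (rule countable_subset) (use D in auto)
    \<comment> \<open>A nonempty fibre of the \<open>p\<close>-th power map is a translate of its
      kernel.\<close>
    have root: "countable {x \<in> carrier G. x [^] p = z}" for z
    proof (cases "\<exists>y \<in> carrier G. y [^] p = z")
      case True
      then obtain y where y: "y \<in> carrier G" "y [^] p = z" by blast
      have "{x \<in> carrier G. x [^] p = z} \<subseteq> (\<lambda>t. t \<otimes> y) ` {x \<in> carrier G. x [^] p = \<one>}"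
      proof
        fix x assume "x \<in> {x \<in> carrier G. x [^] p = z}"
        then have x: "x \<in> carrier G" "x [^] p = z" by auto
        have "(x \<otimes> inv y) [^] p = \<one>"
          using x y by (auto simp: pow_mult_distrib[OF m_comm] nat_pow_inv)
        moreover have "x = x \<otimes> inv y \<otimes> y" using x y by (simp add: m_assoc)
        ultimately show "x \<in> (\<lambda>t. t \<otimes> y) ` {x \<in> carrier G. x [^] p = \<one>}"
          using x y by blast
      qed
      then show ?thesis using tors by (meson countable_image countable_subset)
    next
      case False
      then have "{x \<in> carrier G. x [^] p = z} = {}" by blast
      then show ?thesis by (simp only: countable_empty)
    qed
    let ?R = "{y \<in> carrier G. y [^] m \<in> Z}"
    have "countable ?R" using less.IH[OF \<open>m < n\<close> \<open>m > 0\<close> less.prems(2)] .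
    moreover have "{x \<in> carrier G. x [^] n \<in> Z} \<subseteq> (\<Union>z\<in>?R. {x \<in> carrier G. x [^] p = z})"
      by (auto simp: m nat_pow_pow[symmetric])
    ultimately show ?thesis using root by (meson countable_UN countable_subset)
  qed
qed

text \<open>The quotient is taken by a subgroup \<open>M\<close> maximal among those avoiding the nontrivial quotients
  of elements of a countably infinite set \<open>S\<close>: then \<open>S\<close> embeds into \<open>G/M\<close>, and by maximality every
  nontrivial element of \<open>G/M\<close> has a power in a fixed countable set.\<close>

lemma countable_infinite_quotient:
  assumes inf: "infinite (carrier G)"
  shows "\<exists>M. subgroup M G \<and> infinite (carrier (G Mod M)) \<and> countable (carrier (G Mod M))"
proof -
  obtain S where S: "countable S" "infinite S" "S \<subseteq> carrier G"
    using infinite_countable_subset'[OF inf] by auto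
  define D where "D = (\<lambda>(s, t). s \<otimes> inv t) ` (S \<times> S) - {\<one>}"
  have D: "countable D" "D \<subseteq> carrier G" using S by (auto simp: D_def)
  \<comment> \<open>Root counting takes natural exponents only; closure under inverses lets a
    negative power that hits the image of \<open>D\<close> be replaced by a positive one.\<close>
  have Dinv: "inv d \<in> D" if "d \<in> D" for d
  proof -
    obtain s t where st: "s \<in> S" "t \<in> S" "d = s \<otimes> inv t" "d \<noteq> \<one>"
      using \<open>d \<in> D\<close> by (auto simp: D_def)
    then have "inv d = t \<otimes> inv s" using S by (auto simp: inv_mult_group subset_iff)
    moreover have "inv d \<noteq> \<one>" using st S by (auto simp: inv_eq_1_iff subset_iff)
    ultimately show ?thesis using st by (auto simp: D_def intro!: image_eqI[of _ _ "(t, s)"])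
  qed
  define \<A> where "\<A> = {M. subgroup M G \<and> M \<inter> D = {}}"
  have "\<exists>M\<in>\<A>. \<forall>N\<in>\<A>. M \<subseteq> N \<longrightarrow> N = M"
  proof (rule subset_Zorn_nonempty)
    show "\<A> \<noteq> {}" using triv_subgroup by (auto simp: \<A>_def D_def)
  next
    fix \<C> assume ne: "\<C> \<noteq> {}" and ch: "subset.chain \<A> \<C>"
    have sg: "subgroup M G" if "M \<in> \<C>" for M
      using ch that by (auto simp: subset.chain_def \<A>_def)
    have "subgroup (\<Union>\<C>) G"
    proof (rule subgroupI)
      show "\<Union>\<C> \<subseteq> carrier G" using sg subgroup.subset by blast
      show "\<Union>\<C> \<noteq> {}" using ne sg subgroup.one_closed by blast
      show "inv a \<in> \<Union>\<C>" if "a \<in> \<Union>\<C>" for a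
        using that by (meson UnionE UnionI sg subgroup.m_inv_closed)
      show "a \<otimes> b \<in> \<Union>\<C>" if ab: "a \<in> \<Union>\<C>" "b \<in> \<Union>\<C>" for a b
      proof -
        obtain A B where AB: "A \<in> \<C>" "B \<in> \<C>" "a \<in> A" "b \<in> B" using ab by blast
        then have "A \<subseteq> B \<or> B \<subseteq> A" using ch by (auto simp: subset.chain_def)
        then have "\<exists>M\<in>\<C>. a \<in> M \<and> b \<in> M" using AB by blast
          then show ?thesis by (meson UnionI sg subgroup.m_closed)
      qed
    qed
    then show "\<Union>\<C> \<in> \<A>" using ch by (auto simp: \<A>_def subset.chain_def)
  qed
  then obtain M where M: "subgroup M G" "M \<inter> D = {}"
    and max: "\<And>N. subgroup N G \<Longrightarrow> N \<inter> D = {} \<Longrightarrow> M \<subseteq> N \<Longrightarrow> N = M"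
    by (auto simp: \<A>_def)
  interpret M: subgroup M G by (rule M(1))
  interpret MN: normal M G using M(1) by (rule subgroup_imp_normal)
  interpret Q: comm_group "G Mod M" using M(1) by (rule abelian_FactGroup)
  have eq_iff: "M #> s = M #> t \<longleftrightarrow> s \<otimes> inv t \<in> M" if "s \<in> carrier G" "t \<in> carrier G" for s t
    using that M.rcos_module[OF is_group, of t s] rcos_self[OF _ M(1), of s] repr_independence[OF _ _ M(1), of s t]
    by auto
  have "inj_on (\<lambda>s. M #> s) S"
  proof (rule inj_onI)
    fix s t assume st: "s \<in> S" "t \<in> S" "M #> s = M #> t"
    then have "s \<otimes> inv t \<in> M" using S eq_iff by blast
    then have "s \<otimes> inv t \<notin> D" using M(2) by blast
    then have "s \<otimes> inv t = \<one>" using st by (auto simp: D_def)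
    then show "s = t" using st S by (metis inv_equality inv_closed inv_inv subsetD)
  qed
  then have "infinite ((\<lambda>s. M #> s) ` S)" using S(2) finite_imageD by blast
  moreover have "(\<lambda>s. M #> s) ` S \<subseteq> carrier (G Mod M)" using S(3) by (auto simp: carrier_FactGroup)
  ultimately have inf_Q: "infinite (carrier (G Mod M))" using finite_subset by blast
  let ?D = "(\<lambda>d. M #> d) ` D"
  have ess: "\<exists>n::nat. q [^]\<^bsub>G Mod M\<^esub> n \<in> ?D - {\<one>\<^bsub>G Mod M\<^esub>}"
    if q: "q \<in> carrier (G Mod M)" "q \<noteq> \<one>\<^bsub>G Mod M\<^esub>" for q
  proof -
    obtain a where a: "a \<in> carrier G" "q = M #> a" using q(1) by (auto simp: carrier_FactGroup)
    have "a \<notin> M" using q(2) a M.rcos_const by auto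
    \<comment> \<open>The subgroup generated by \<open>M\<close> and \<open>a\<close> properly
      contains \<open>M\<close>, so by maximality it meets \<open>D\<close>. An element of the
      intersection is an integer power of \<open>a\<close> modulo \<open>M\<close>.\<close>
    define N where "N = {m \<otimes> a [^] k | m (k::int). m \<in> M}"
    have "subgroup N G"
    proof (rule subgroupI)
      show "N \<subseteq> carrier G" using a by (auto simp: N_def)
      show "N \<noteq> {}" unfolding N_def using M.one_closed by blast
      show "inv x \<in> N" if "x \<in> N" for x
      proof -
        obtain m and k :: int where "m \<in> M" "x = m \<otimes> a [^] k" using \<open>x \<in> N\<close> by (auto simp: N_def)
        then have "inv x = inv m \<otimes> a [^] (- k)" using a by (simp add: inv_mult int_pow_neg)
        then show ?thesis using \<open>m \<in> M\<close> by (auto simp: N_def)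
      qed
      show "x \<otimes> y \<in> N" if xy: "x \<in> N" "y \<in> N" for x y
      proof -
        obtain m n and k l :: int where "m \<in> M" "n \<in> M" "x = m \<otimes> a [^] k" "y = n \<otimes> a [^] l"
          using xy unfolding N_def by blast
        then have "x \<otimes> y = (m \<otimes> n) \<otimes> a [^] (k + l)" using a by (simp add: int_pow_mult m_ac)
        then show ?thesis using \<open>m \<in> M\<close> \<open>n \<in> M\<close> by (auto simp: N_def)
      qed
    qed
    moreover have "M \<subseteq> N"
    proof
      fix m assume "m \<in> M"
      then have "m = m \<otimes> a [^] (0::int)" by simp
      then show "m \<in> N" using \<open>m \<in> M\<close> unfolding N_def by blast
    qed
    moreover have "a \<in> N"
    proof -
      have "a = \<one> \<otimes> a [^] (1::int)" using a by (simp add: int_pow_1)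
      then show ?thesis using M.one_closed unfolding N_def by blast
    qed
    ultimately obtain d where "d \<in> N" "d \<in> D" using max[of N] \<open>a \<notin> M\<close> by blast
    then obtain m and k :: int where m: "m \<in> M" "d = m \<otimes> a [^] k" by (auto simp: N_def)
    have dk: "M #> d = q [^]\<^bsub>G Mod M\<^esub> k"
    proof -
      have "M #> d = (M #> m) #> a [^] k" using m a by (simp add: coset_mult_assoc M.subset)
      also have "\<dots> = M #> a [^] k" using m M.rcos_const by simp
      also have "\<dots> = q [^]\<^bsub>G Mod M\<^esub> k" using a MN.FactGroup_int_pow[of a k] by simp
      finally show ?thesis .
    qed
    have nontriv: "M #> d' \<noteq> \<one>\<^bsub>G Mod M\<^esub>" if "d' \<in> D" for d'
      using that M(2) D eq_iff[of d' \<one>] by (auto simp: coset_mult_one[OF M.subset])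
    show ?thesis
    proof (cases "k \<ge> 0")
      case True
      then have "q [^]\<^bsub>G Mod M\<^esub> (nat k) = M #> d" by (simp add: dk int_pow_int[symmetric])
      then show ?thesis using \<open>d \<in> D\<close> nontriv by blast
    next
      case False
      have "M #> inv d = inv\<^bsub>G Mod M\<^esub> (M #> d)"
        using \<open>d \<in> D\<close> D group_hom.hom_inv[of G "G Mod M" "\<lambda>x. M #> x" d] MN.r_coset_hom_Mod
          Q.group_axioms is_group by (auto simp: group_hom_def group_hom_axioms_def)
      also have "\<dots> = q [^]\<^bsub>G Mod M\<^esub> (nat (- k))"
        using False q(1) by (simp add: dk Q.int_pow_neg[symmetric] int_pow_int[symmetric])
      finally show ?thesis using Dinv[OF \<open>d \<in> D\<close>] nontriv by (metis DiffI imageI singletonD)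
    qed
  qed
  \<comment> \<open>The image of \<open>D\<close> plays two roles here: it is the set in which every
    nontrivial element has a power, and the set whose roots are counted.\<close>
  have Q_roots: "countable {q \<in> carrier (G Mod M). q [^]\<^bsub>G Mod M\<^esub> (n::nat) \<in> ?D}" if "n > 0" for n
    by (rule Q.countable_torsion_roots[OF _ _ ess that]) (use D in \<open>auto simp: carrier_FactGroup\<close>)
  have "carrier (G Mod M) \<subseteq> insert \<one>\<^bsub>G Mod M\<^esub>
      (\<Union>n\<in>{0<..}. {q \<in> carrier (G Mod M). q [^]\<^bsub>G Mod M\<^esub> (n::nat) \<in> ?D})"
  proof
    fix q assume q: "q \<in> carrier (G Mod M)"
    show "q \<in> insert \<one>\<^bsub>G Mod M\<^esub> (\<Union>n\<in>{0<..}. {q \<in> carrier (G Mod M). q [^]\<^bsub>G Mod M\<^esub> (n::nat) \<in> ?D})"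
    proof (cases "q = \<one>\<^bsub>G Mod M\<^esub>")
      case False
      then obtain n :: nat where n: "q [^]\<^bsub>G Mod M\<^esub> n \<in> ?D" "q [^]\<^bsub>G Mod M\<^esub> n \<noteq> \<one>\<^bsub>G Mod M\<^esub>"
        using ess[OF q] by blast
      then have "n \<noteq> 0" by (metis Q.nat_pow_0)
      then show ?thesis using n q by auto
    qed simp
  qed
  then have "countable (carrier (G Mod M))"
    by (rule countable_subset) (use Q_roots in auto)
  then show ?thesis using M(1) inf_Q by blast
qed

text \<open>Conjugation is trivial, so an injective enumeration \<open>e\<close> is an admissible
  weight with all elements as generators. A bound \<open>N\<close> on the weighted length restricts
  every word to at most \<open>N\<close> letters from the finite set where \<open>e\<close> is at
  most \<open>N\<close>, which leaves finitely many products.\<close>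

lemma bounded_countable_imp_finite:
  assumes bdd: "bounded_group G" and ctb: "countable (carrier G)"
  shows "finite (carrier G)"
proof -
  obtain e :: "'a \<Rightarrow> nat" where e: "inj_on e (carrier G)" using ctb by (auto simp: countable_def)
  have conj: "k \<otimes> y \<otimes> inv k = y" if "k \<in> carrier G" "y \<in> carrier G" for k y
    using that by (simp add: m_comm[of k y] m_assoc)
  have "\<exists>N. \<forall>g\<in>carrier G. \<exists>ys. set ys \<subseteq> carrier G \<and> g = list_product G ys
      \<and> sum_list (map (Suc \<circ> e) ys) \<le> N"
  proof (rule bounded_group_generation[OF bdd])
    show "\<exists>ys. set ys \<subseteq> carrier G \<and> g = list_product G ys" if "g \<in> carrier G" for g
      using that by (intro exI[of _ "[g]"]) simp
  qed (simp_all add: conj)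
  then obtain N where N: "\<And>g. g \<in> carrier G \<Longrightarrow> \<exists>ys. set ys \<subseteq> carrier G \<and> g = list_product G ys
      \<and> sum_list (map (Suc \<circ> e) ys) \<le> N" by blast
  let ?B = "{y \<in> carrier G. e y \<le> N}"
  have "finite ?B"
    by (rule inj_on_finite[of e _ "{..N}"]) (use e in \<open>auto intro: inj_on_subset\<close>)
  then have "finite (list_product G ` {ys. set ys \<subseteq> ?B \<and> length ys \<le> N})"
    by (intro finite_imageI finite_lists_length_le)
  moreover have "carrier G \<subseteq> list_product G ` {ys. set ys \<subseteq> ?B \<and> length ys \<le> N}"
  proof
    fix g assume "g \<in> carrier G"
    then obtain ys where ys: "set ys \<subseteq> carrier G" "g = list_product G ys"
      "sum_list (map (Suc \<circ> e) ys) \<le> N" using N by blast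
    have "e y \<le> N" if "y \<in> set ys" for y
      using member_le_sum_list[of "Suc (e y)" "map (Suc \<circ> e) ys"] that ys(3) by force
    moreover have "length ys \<le> sum_list (map (Suc \<circ> e) ys)" by (induction ys) auto
    ultimately show "g \<in> list_product G ` {ys. set ys \<subseteq> ?B \<and> length ys \<le> N}"
      using ys by auto
  qed
  ultimately show ?thesis by (rule finite_subset[rotated])
qed

theorem bounded_imp_finite:
  assumes bdd: "bounded_group G"
  shows "finite (carrier G)"
proof (rule ccontr)
  assume "infinite (carrier G)"
  then obtain M where M: "subgroup M G" "infinite (carrier (G Mod M))" "countable (carrier (G Mod M))"
    using countable_infinite_quotient by blast
  interpret Q: comm_group "G Mod M" using M(1) by (rule abelian_FactGroup)
  show False
    using Q.bounded_countable_imp_finite[OF bounded_group_FactGroup[OF bdd subgroup_imp_normal[OF M(1)]]] M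
    by blast
qed

end

section \<open>Commutator width\<close>

definition commutator :: "('a, 'b) monoid_scheme \<Rightarrow> 'a \<Rightarrow> 'a \<Rightarrow> 'a" where
  "commutator G x y = x \<otimes>\<^bsub>G\<^esub> y \<otimes>\<^bsub>G\<^esub> inv\<^bsub>G\<^esub> x \<otimes>\<^bsub>G\<^esub> inv\<^bsub>G\<^esub> y"

text \<open>Balls for commutator length: radii add under products, and conjugation preserves them
  when \<open>K\<close> is normal. The bound in \<open>uniformly_perfect\<close> says that the group
  lies in one such ball formed with its own carrier.\<close>

definition commutator_ball :: "('a, 'b) monoid_scheme \<Rightarrow> 'a set \<Rightarrow> nat \<Rightarrow> 'a set" where
  "commutator_ball G K n = {list_product G cs | cs. length cs \<le> n \<and> set cs \<subseteq> derived_set G K}"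

section \<open>Commutator identities and the count of commutators in a product\<close>

context group
begin

lemma inv_mult_cancel:
  "x \<in> carrier G \<Longrightarrow> y \<in> carrier G \<Longrightarrow> inv x \<otimes> (x \<otimes> y) = y"
  "x \<in> carrier G \<Longrightarrow> y \<in> carrier G \<Longrightarrow> x \<otimes> (inv x \<otimes> y) = y"
  by (simp_all add: m_assoc[symmetric])

lemma commutator_closed [simp]:
  "x \<in> carrier G \<Longrightarrow> y \<in> carrier G \<Longrightarrow> commutator G x y \<in> carrier G"
  by (simp add: commutator_def)

lemma commutator_in_derived:
  "x \<in> K \<Longrightarrow> y \<in> K \<Longrightarrow> commutator G x y \<in> derived G K"
  unfolding commutator_def derived_def by (rule generate.incl) blast

lemma commutator_eq_one:
  assumes "x \<in> carrier G" "y \<in> carrier G" "x \<otimes> y = y \<otimes> x"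
  shows "commutator G x y = \<one>"
  using assms by (simp add: commutator_def m_assoc inv_mult_cancel)

lemma commutator_mult_left:
  assumes "a \<in> carrier G" "b \<in> carrier G" "x \<in> carrier G"
  shows "commutator G (a \<otimes> b) x = (a \<otimes> commutator G b x \<otimes> inv a) \<otimes> commutator G a x"
  using assms by (simp add: commutator_def m_assoc inv_mult_cancel inv_mult_group)

lemma commutator_mult_right:
  assumes "a \<in> carrier G" "b \<in> carrier G" "x \<in> carrier G"
  shows "commutator G x (a \<otimes> b) = commutator G x a \<otimes> (a \<otimes> commutator G x b \<otimes> inv a)"
  using assms by (simp add: commutator_def m_assoc inv_mult_cancel inv_mult_group)

text \<open>This identity and the next record that a conjugate stays in the same class modulo the
  commutator subgroup, with the correcting factor made explicit.\<close>

lemma conj_eq_commutator_mult: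
  assumes "k \<in> carrier G" "x \<in> carrier G"
  shows "k \<otimes> x \<otimes> inv k = commutator G k x \<otimes> x"
  using assms by (simp add: commutator_def m_assoc inv_mult_cancel)

lemma eq_commutator_mult_conj:
  assumes "k \<in> carrier G" "x \<in> carrier G"
  shows "x = commutator G x k \<otimes> (k \<otimes> x \<otimes> inv k)"
  using assms by (simp add: commutator_def m_assoc inv_mult_cancel)

lemma conj_commutator:
  assumes "k \<in> carrier G" "x \<in> carrier G" "y \<in> carrier G"
  shows "k \<otimes> commutator G x y \<otimes> inv k = commutator G (k \<otimes> x \<otimes> inv k) (k \<otimes> y \<otimes> inv k)"
  using assms by (simp add: commutator_def m_assoc inv_mult_cancel inv_mult_group)

lemma inv_commutator:
  assumes "x \<in> carrier G" "y \<in> carrier G"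
  shows "inv (commutator G x y) = commutator G y x"
  using assms by (simp add: commutator_def m_assoc inv_mult_group)

lemma derived_set_eq: "derived_set G K = {commutator G x y | x y. x \<in> K \<and> y \<in> K}"
  by (auto simp: commutator_def)

lemma commutator_ball_closed:
  assumes "K \<subseteq> carrier G" "x \<in> commutator_ball G K n"
  shows "x \<in> carrier G"
  using assms derived_set_in_carrier[of K] by (auto simp: commutator_ball_def)

lemma one_in_commutator_ball [simp]: "\<one> \<in> commutator_ball G K n"
  by (auto simp: commutator_ball_def intro!: exI[of _ "[]"])

lemma commutator_in_commutator_ball:
  assumes "K \<subseteq> carrier G" "x \<in> K" "y \<in> K"
  shows "commutator G x y \<in> commutator_ball G K 1"
proof -
  have "x \<in> carrier G" "y \<in> carrier G" using assms by auto
  then have "list_product G [commutator G x y] = commutator G x y" by simp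
  then show ?thesis using assms unfolding commutator_ball_def derived_set_eq
    by (intro CollectI exI[of _ "[commutator G x y]"]) auto
qed

lemma commutator_ball_mono: "m \<le> n \<Longrightarrow> x \<in> commutator_ball G K m \<Longrightarrow> x \<in> commutator_ball G K n"
  by (auto simp: commutator_ball_def)

lemma commutator_ball_mult:
  assumes K: "K \<subseteq> carrier G" and x: "x \<in> commutator_ball G K m" and y: "y \<in> commutator_ball G K n"
  shows "x \<otimes> y \<in> commutator_ball G K (m + n)"
proof -
  obtain xs ys where "length xs \<le> m" "set xs \<subseteq> derived_set G K" "x = list_product G xs"
    and "length ys \<le> n" "set ys \<subseteq> derived_set G K" "y = list_product G ys"
    using x y by (auto simp: commutator_ball_def)
  then show ?thesis
    using derived_set_in_carrier[OF K] unfolding commutator_ball_def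
    by (intro CollectI exI[of _ "xs @ ys"]) (auto simp: list_product_append)
qed

text \<open>Conjugation distributes over commutators and preserves the normal subgroup
  \<open>K\<close>. Hence the conjugating factors in \<open>commutator_mult_left\<close> and
  \<open>commutator_mult_right\<close> cost nothing when commutators are counted.\<close>

lemma commutator_ball_conj:
  assumes K: "K \<lhd> G" and k: "k \<in> carrier G" and x: "x \<in> commutator_ball G K n"
  shows "k \<otimes> x \<otimes> inv k \<in> commutator_ball G K n"
proof -
  interpret K: normal K G by (rule K)
  obtain xs where xs: "length xs \<le> n" "set xs \<subseteq> derived_set G K" "x = list_product G xs"
    using x by (auto simp: commutator_ball_def)
  have "k \<otimes> y \<otimes> inv k \<in> derived_set G K" if "y \<in> derived_set G K" for y
  proof -
    obtain a b where ab: "a \<in> K" "b \<in> K" "y = commutator G a b"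
      using \<open>y \<in> derived_set G K\<close> unfolding derived_set_eq by blast
    then have "k \<otimes> y \<otimes> inv k = commutator G (k \<otimes> a \<otimes> inv k) (k \<otimes> b \<otimes> inv k)"
      using conj_commutator[OF k] K.subset by auto
    then show ?thesis using K.inv_op_closed2[OF k] ab unfolding derived_set_eq by blast
  qed
  then have "set (map (\<lambda>y. k \<otimes> y \<otimes> inv k) xs) \<subseteq> derived_set G K"
    using subsetD[OF xs(2)] unfolding set_map image_subset_iff by meson
  moreover have "k \<otimes> x \<otimes> inv k = list_product G (map (\<lambda>y. k \<otimes> y \<otimes> inv k) xs)"
    unfolding xs(3) by (rule conj_list_product) (use k xs derived_set_in_carrier[OF K.subset] in auto)
  ultimately show ?thesis
    using xs(1) unfolding commutator_ball_def by (metis (mono_tags, lifting) CollectI length_map)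
qed

lemma derived_in_commutator_ball:
  assumes K: "K \<subseteq> carrier G" and h: "h \<in> derived G K"
  shows "\<exists>n. h \<in> commutator_ball G K n"
  using h unfolding derived_def
proof (induction rule: generate.induct)
  case one
  show ?case by auto
next
  case (incl h)
  then show ?case using commutator_in_commutator_ball[OF K] unfolding derived_set_eq by blast
next
  case (inv h)
  then obtain x y where xy: "x \<in> K" "y \<in> K" "h = commutator G x y" unfolding derived_set_eq by blast
  then have "inv h = commutator G y x" using K inv_commutator by blast
  then show ?case using commutator_in_commutator_ball[OF K] xy by auto
next
  case (eng h1 h2)
  then show ?case using commutator_ball_mult[OF K] by blast
qed

lemma commutator_ball_subset_derived:
  assumes K: "K \<subseteq> carrier G"
  shows "commutator_ball G K n \<subseteq> derived G K"
proof
  fix x assume "x \<in> commutator_ball G K n"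
  then obtain xs where xs: "set xs \<subseteq> derived_set G K" "x = list_product G xs"
    by (auto simp: commutator_ball_def)
  interpret D: subgroup "derived G K" G using derived_is_subgroup[OF K] .
  have "derived_set G K \<subseteq> derived G K"
    unfolding derived_def by (rule subsetI) (rule generate.incl)
  with xs(1) have "set xs \<subseteq> derived G K" by (rule subset_trans)
  then have "list_product G xs \<in> derived G K" by (induction xs) auto
  then show "x \<in> derived G K" using xs(2) by simp
qed

text \<open>Peeling off one letter with \<open>commutator_mult_left\<close> costs one commutator
  with that letter, hence \<open>m\<close> factors, and conjugates the rest, which is free.\<close>

lemma commutator_list_product_left:
  assumes K: "K \<lhd> G" and x: "x \<in> carrier G" and ys: "set ys \<subseteq> carrier G"
    and comm: "\<And>y. y \<in> set ys \<Longrightarrow> commutator G y x \<in> commutator_ball G K m"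
  shows "commutator G (list_product G ys) x \<in> commutator_ball G K (length ys * m)"
  using ys comm
proof (induction ys)
  case Nil
  then show ?case using x by (simp add: commutator_def)
next
  case (Cons y ys)
  have KG: "K \<subseteq> carrier G" using K normal_imp_subgroup subgroup.subset by blast
  have "y \<otimes> commutator G (list_product G ys) x \<otimes> inv y \<in> commutator_ball G K (length ys * m)"
    by (rule commutator_ball_conj[OF K]) (use Cons in auto)
  from commutator_ball_mult[OF KG this, of "commutator G y x" m] show ?case
    using Cons.prems x by (simp add: commutator_mult_left add.commute)
qed

lemma commutator_list_product_right:
  assumes K: "K \<lhd> G" and x: "x \<in> carrier G" and ys: "set ys \<subseteq> carrier G"
    and comm: "\<And>y. y \<in> set ys \<Longrightarrow> commutator G x y \<in> commutator_ball G K m"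
  shows "commutator G x (list_product G ys) \<in> commutator_ball G K (length ys * m)"
  using ys comm
proof (induction ys)
  case Nil
  then show ?case using x by (simp add: commutator_def)
next
  case (Cons y ys)
  have KG: "K \<subseteq> carrier G" using K normal_imp_subgroup subgroup.subset by blast
  have "y \<otimes> commutator G x (list_product G ys) \<otimes> inv y \<in> commutator_ball G K (length ys * m)"
    by (rule commutator_ball_conj[OF K]) (use Cons in auto)
  from commutator_ball_mult[OF KG _ this, of "commutator G x y" m] show ?case
    using Cons.prems x by (simp add: commutator_mult_right)
qed

section \<open>Uniform bounds on commutator length\<close>

lemma bounded_imp_finite_abelianization:
  assumes "bounded_group G"
  shows "finite (carrier (G Mod derived G (carrier G)))"
  using comm_group.bounded_imp_finite[OF derived_quot_is_comm_group]
    bounded_group_FactGroup[OF assms derived_self_is_normal] .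

text \<open>Let \<open>T\<close> be a finite set of representatives of the cosets of the commutator
  subgroup. Conjugates of \<open>T\<close> and all commutators form a conjugation-invariant
  generating set, so every element is a product of at most \<open>N\<close> of these. Collecting the
  commutators on the left leaves a word of bounded length in \<open>T\<close>; for an element of the
  commutator subgroup its value is one of finitely many elements of that subgroup, and their
  commutator lengths have a maximum.\<close>

lemma bounded_commutator_width:
  assumes bdd: "bounded_group G"
  shows "\<exists>M. derived G (carrier G) \<subseteq> commutator_ball G (carrier G) M"
proof -
  let ?H = "derived G (carrier G)"
  interpret H: normal ?H G by (rule derived_self_is_normal)
  define T where "T = (\<lambda>q. SOME x. x \<in> carrier G \<and> q = ?H #> x) ` carrier (G Mod ?H)"
  have rep: "(SOME x. x \<in> carrier G \<and> q = ?H #> x) \<in> carrier G"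
    "q = ?H #> (SOME x. x \<in> carrier G \<and> q = ?H #> x)" if "q \<in> carrier (G Mod ?H)" for q
    using someI_ex[of "\<lambda>x. x \<in> carrier G \<and> q = ?H #> x"] that by (auto simp: carrier_FactGroup)
  have "finite T" unfolding T_def using bounded_imp_finite_abelianization[OF bdd] by blast
  have T: "T \<subseteq> carrier G" unfolding T_def using rep(1) by blast
  have decomp: "\<exists>t\<in>T. \<exists>h\<in>?H. g = h \<otimes> t" if "g \<in> carrier G" for g
  proof -
    have "?H #> g \<in> carrier (G Mod ?H)" using that by (auto simp: carrier_FactGroup)
    then obtain t where t: "t \<in> T" "?H #> g = ?H #> t" using rep(2) unfolding T_def by blast
    have "g \<in> ?H #> t" using rcos_self[OF that H.subgroup_axioms] t(2) by simp
    then show ?thesis using t(1) by (auto simp: r_coset_def)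
  qed
  define Y where "Y = {k \<otimes> t \<otimes> inv k | k t. k \<in> carrier G \<and> t \<in> T} \<union> derived_set G (carrier G)"
  have Yc: "Y \<subseteq> carrier G" using T derived_set_in_carrier[of "carrier G"] unfolding Y_def by blast
  have TY: "T \<subseteq> Y"
  proof
    fix t assume "t \<in> T"
    then have "t = \<one> \<otimes> t \<otimes> inv \<one>" using T by auto
    then show "t \<in> Y" using \<open>t \<in> T\<close> unfolding Y_def by blast
  qed
  have "\<exists>N. \<forall>g\<in>carrier G. \<exists>ys. set ys \<subseteq> Y \<and> g = list_product G ys
      \<and> sum_list (map (Suc \<circ> (\<lambda>_. 0)) ys) \<le> N"
  proof (rule bounded_group_generation[OF bdd Yc])
    fix k y assume k: "k \<in> carrier G" and y: "y \<in> Y"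
    show "k \<otimes> y \<otimes> inv k \<in> Y"
    proof (cases "y \<in> derived_set G (carrier G)")
      case True
      then obtain a b where ab: "a \<in> carrier G" "b \<in> carrier G" "y = commutator G a b"
        unfolding derived_set_eq by blast
      then have "k \<otimes> y \<otimes> inv k = commutator G (k \<otimes> a \<otimes> inv k) (k \<otimes> b \<otimes> inv k)"
        using conj_commutator[OF k] by simp
      moreover have "k \<otimes> a \<otimes> inv k \<in> carrier G" "k \<otimes> b \<otimes> inv k \<in> carrier G" using k ab by auto
      ultimately show ?thesis unfolding Y_def derived_set_eq by blast
    next
      case False
      then obtain l t where lt: "l \<in> carrier G" "t \<in> T" "y = l \<otimes> t \<otimes> inv l"
        using y unfolding Y_def by blast
      then have "k \<otimes> y \<otimes> inv k = (k \<otimes> l) \<otimes> t \<otimes> inv (k \<otimes> l)"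
        using k T by (auto simp: m_assoc inv_mult_group)
      then show ?thesis using k lt unfolding Y_def by blast
    qed
  next
    fix g assume "g \<in> carrier G"
    then obtain t h where th: "t \<in> T" "h \<in> ?H" "g = h \<otimes> t" using decomp by blast
    then obtain n where "h \<in> commutator_ball G (carrier G) n" using derived_in_commutator_ball by blast
    then obtain cs where cs: "set cs \<subseteq> derived_set G (carrier G)" "h = list_product G cs"
      by (auto simp: commutator_ball_def)
    have csY: "set cs \<subseteq> Y" using cs(1) unfolding Y_def by blast
    have "g = list_product G (cs @ [t])"
      using th cs(2) T csY Yc by (subst list_product_append) auto
    then show "\<exists>ys. set ys \<subseteq> Y \<and> g = list_product G ys"
      using csY th(1) TY by (intro exI[of _ "cs @ [t]"]) auto
  qed simp
  then obtain N where N: "\<And>g. g \<in> carrier G \<Longrightarrow> \<exists>ys. set ys \<subseteq> Y \<and> g = list_product G ys \<and> length ys \<le> N"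
    by (auto simp: comp_def sum_list_triv)
  let ?C = "commutator_ball G (carrier G)"
  \<comment> \<open>Each generator is a representative up to one commutator; the identity is added
    to \<open>T\<close> to represent the generators that are commutators themselves.\<close>
  have Yrep: "\<exists>t\<in>insert \<one> T. \<exists>c\<in>?C 1. y = c \<otimes> t" if "y \<in> Y" for y
    using that unfolding Y_def
  proof (elim UnE)
    assume "y \<in> derived_set G (carrier G)"
    then have "y \<in> ?C 1" using commutator_in_commutator_ball[of "carrier G"] unfolding derived_set_eq by blast
    then show ?thesis using commutator_ball_closed[of "carrier G" y 1] by (intro bexI[of _ \<one>] bexI[of _ y]) auto
  next
    assume "y \<in> {k \<otimes> t \<otimes> inv k | k t. k \<in> carrier G \<and> t \<in> T}"
    then obtain k t where kt: "k \<in> carrier G" "t \<in> T" "y = k \<otimes> t \<otimes> inv k" by blast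
    then have "y = commutator G k t \<otimes> t" using conj_eq_commutator_mult T by blast
    moreover have "commutator G k t \<in> ?C 1" using kt T by (intro commutator_in_commutator_ball) auto
    ultimately show ?thesis using kt(2) by blast
  qed
  \<comment> \<open>Moving the commutators already collected past a further \<open>t\<close>
    replaces them by their conjugates under \<open>t\<close>, so their number does not grow.\<close>
  have prod_rep: "\<exists>ts. set ts \<subseteq> insert \<one> T \<and> length ts = length ys \<and>
      (\<exists>c\<in>?C (length ys). list_product G ys = c \<otimes> list_product G ts)" if "set ys \<subseteq> Y" for ys
    using that
  proof (induction ys)
    case Nil
    show ?case by (auto intro!: bexI[of _ \<one>])
  next
    case (Cons y ys)
    then obtain ts c where ts: "set ts \<subseteq> insert \<one> T" "length ts = length ys" "c \<in> ?C (length ys)"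
      "list_product G ys = c \<otimes> list_product G ts" by auto
    obtain t d where t: "t \<in> insert \<one> T" "d \<in> ?C 1" "y = d \<otimes> t" using Yrep Cons.prems by force
    have cl: "t \<in> carrier G" "c \<in> carrier G" "d \<in> carrier G" "list_product G ts \<in> carrier G"
      using t ts T commutator_ball_closed[of "carrier G"] by (auto intro!: list_product_closed)
    have "list_product G (y # ys) = (d \<otimes> (t \<otimes> c \<otimes> inv t)) \<otimes> list_product G (t # ts)"
      using cl by (simp add: t(3) ts(4) m_assoc inv_mult_cancel)
    moreover have "d \<otimes> (t \<otimes> c \<otimes> inv t) \<in> ?C (1 + length ys)"
      using t ts cl by (intro commutator_ball_mult commutator_ball_conj normal_self) auto
    ultimately show ?case using ts t by (intro exI[of _ "t # ts"]) auto
  qed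
  let ?P = "list_product G ` {ts. set ts \<subseteq> insert \<one> T \<and> length ts \<le> N} \<inter> ?H"
  have "finite ?P" using \<open>finite T\<close> by (intro finite_Int disjI1 finite_imageI finite_lists_length_le) auto
  moreover obtain n where n: "\<And>p. p \<in> ?H \<Longrightarrow> p \<in> ?C (n p)"
    using derived_in_commutator_ball[of "carrier G"] by (metis subset_refl)
  ultimately have bound: "p \<in> ?C (Max (n ` ?P))" if "p \<in> ?P" for p
    using that by (intro commutator_ball_mono[OF _ n]) auto
  have "h \<in> ?C (N + Max (n ` ?P))" if h: "h \<in> ?H" for h
  proof -
    have hG: "h \<in> carrier G" using h H.subset by blast
    then obtain ys where ys: "set ys \<subseteq> Y" "h = list_product G ys" "length ys \<le> N" using N by blast
    then obtain ts c where ts: "set ts \<subseteq> insert \<one> T" "length ts = length ys" "c \<in> ?C (length ys)"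
      "h = c \<otimes> list_product G ts" using prod_rep by blast
    have cH: "c \<in> ?H" using commutator_ball_subset_derived ts(3) by blast
    have tsG: "list_product G ts \<in> carrier G" using ts(1) T by (auto intro!: list_product_closed)
    have "list_product G ts = inv c \<otimes> h" using cH tsG H.subset by (auto simp: ts(4) inv_mult_cancel)
    then have "list_product G ts \<in> ?H" using cH h by simp
    then have "list_product G ts \<in> ?P" using ts(1,2) ys(3) by auto
    then have "list_product G ts \<in> ?C (Max (n ` ?P))" by (rule bound)
    moreover have "c \<in> ?C N" using ts(3) ys(3) commutator_ball_mono by blast
    ultimately show ?thesis unfolding ts(4) by (intro commutator_ball_mult) auto
  qed
  then show ?thesis by blast
qed

text \<open>Every element is a product of at most \<open>N\<close> generators, so a commutator of
  two arbitrary elements expands into at most \<open>N * N\<close> conjugated commutators of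
  generators, each costing \<open>m\<close>. As elements of the commutator subgroup are products of
  at most \<open>M\<close> commutators, the bounds multiply.\<close>

theorem bounded_imp_uniformly_perfect_derived:
  assumes bdd: "bounded_group G" and Y: "Y \<subseteq> carrier G"
    and Y_conj: "\<And>k y. k \<in> carrier G \<Longrightarrow> y \<in> Y \<Longrightarrow> k \<otimes> y \<otimes> inv k \<in> Y"
    and gen: "\<And>g. g \<in> carrier G \<Longrightarrow> \<exists>ys. set ys \<subseteq> Y \<and> g = list_product G ys"
    and comm: "\<And>x y. x \<in> Y \<Longrightarrow> y \<in> Y \<Longrightarrow>
      commutator G x y \<in> commutator_ball G (derived G (carrier G)) m"
  shows "uniformly_perfect (G\<lparr>carrier := derived G (carrier G)\<rparr>)"
proof -
  let ?H = "derived G (carrier G)"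
  interpret H: normal ?H G by (rule derived_self_is_normal)
  have "\<exists>N. \<forall>g\<in>carrier G. \<exists>ys. set ys \<subseteq> Y \<and> g = list_product G ys
      \<and> sum_list (map (Suc \<circ> (\<lambda>_. 0)) ys) \<le> N"
    by (rule bounded_group_generation[OF bdd Y Y_conj _ gen]) auto
  then obtain N where N: "\<And>g. g \<in> carrier G \<Longrightarrow> \<exists>ys. set ys \<subseteq> Y \<and> g = list_product G ys \<and> length ys \<le> N"
    by (auto simp: comp_def sum_list_triv)
  let ?C = "commutator_ball G ?H"
  have comm_G: "commutator G g k \<in> ?C (N * (N * m))" if g: "g \<in> carrier G" and k: "k \<in> carrier G" for g k
  proof -
    obtain xs ys where xs: "set xs \<subseteq> Y" "g = list_product G xs" "length xs \<le> N"
      and ys: "set ys \<subseteq> Y" "k = list_product G ys" "length ys \<le> N" using N g k by metis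
    have "commutator G x k \<in> ?C (N * m)" if "x \<in> Y" for x
    proof -
      have "commutator G x k \<in> ?C (length ys * m)" unfolding ys(2)
        by (rule commutator_list_product_right[OF derived_self_is_normal]) (use that Y ys comm in auto)
      then show ?thesis using ys(3) by (auto intro: commutator_ball_mono[rotated])
    qed
    then have "commutator G g k \<in> ?C (length xs * (N * m))" unfolding xs(2)
      by (intro commutator_list_product_left[OF derived_self_is_normal]) (use xs k Y in auto)
    then show ?thesis using xs(3) by (auto intro: commutator_ball_mono[rotated])
  qed
  have prod_C: "list_product G cs \<in> ?C (length cs * (N * (N * m)))"
    if "set cs \<subseteq> derived_set G (carrier G)" for cs
    using that
  proof (induction cs)
    case (Cons c cs)
    have "c \<in> ?C (N * (N * m))" using Cons.prems comm_G unfolding derived_set_eq by auto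
    moreover have "list_product G cs \<in> ?C (length cs * (N * (N * m)))"
      by (rule Cons.IH) (use Cons.prems in simp)
    ultimately have "c \<otimes> list_product G cs \<in> ?C (N * (N * m) + length cs * (N * (N * m)))"
      by (rule commutator_ball_mult[OF H.subset])
    then show ?case by simp
  qed simp
  obtain M where M: "?H \<subseteq> commutator_ball G (carrier G) M" using bounded_commutator_width[OF bdd] by blast
  \<comment> \<open>The summand 1 serves the positivity of the bound demanded by
    \<open>uniformly_perfect\<close>.\<close>
  define R where "R = M * (N * (N * m)) + 1"
  have HC: "h \<in> ?C R" if h: "h \<in> ?H" for h
  proof -
    obtain cs where cs: "length cs \<le> M" "set cs \<subseteq> derived_set G (carrier G)" "h = list_product G cs"
      using subsetD[OF M h] unfolding commutator_ball_def by blast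
    have "length cs * (N * (N * m)) \<le> R" using cs(1) unfolding R_def by (simp add: le_SucI)
    then show ?thesis using prod_C[OF cs(2)] cs(3) commutator_ball_mono by blast
  qed
  have ds: "derived_set (G\<lparr>carrier := ?H\<rparr>) ?H = derived_set G ?H"
    by (rule derived_set_consistent) (auto intro: H.subgroup_axioms)
  have d: "derived (G\<lparr>carrier := ?H\<rparr>) ?H = derived G ?H"
    by (rule derived_consistent) (auto intro: H.subgroup_axioms)
  have cH: "carrier (G\<lparr>carrier := ?H\<rparr>) = ?H" by simp
  have lp: "list_product (G\<lparr>carrier := ?H\<rparr>) = list_product G"
    by (simp add: fun_eq_iff list_product_def)
  show ?thesis
    unfolding uniformly_perfect_def cH d ds lp
  proof (intro conjI exI[of _ R] ballI)
    show "?H = derived G ?H"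
      using HC commutator_ball_subset_derived[OF H.subset] derived_incl[OF subset_refl H.subgroup_axioms]
      by blast
    show "R > 0" by (simp add: R_def)
    show "\<exists>cs. length cs \<le> R \<and> set cs \<subseteq> derived_set G ?H \<and> h = list_product G cs" if "h \<in> ?H" for h
      using HC[OF that] unfolding commutator_ball_def by blast
  qed
qed

end

section \<open>Homeomorphisms with small support\<close>

locale homeo_subgroup =
  fixes X :: "'a topology" and G :: "('a \<Rightarrow> 'a) set"
  assumes subgroup_G: "subgroup G (homeo_group X)"
begin

abbreviation S where "S \<equiv> topspace X"

text \<open>The results above concern the full carrier of a group, so \<open>G\<close> is made a
  group of its own instead of being kept as a subgroup.\<close>

definition \<G> where "\<G> = (homeo_group X)\<lparr>carrier := G\<rparr>"

lemma carrier_\<G> [simp]: "carrier \<G> = G"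
  by (simp add: \<G>_def)

sublocale group \<G>
  unfolding \<G>_def by (rule subgroup.subgroup_is_group[OF subgroup_G group_homeo_group])

abbreviation H where "H \<equiv> derived \<G> G"

sublocale H: normal H \<G>
  using derived_self_is_normal by simp

abbreviation ball\<^sub>H where "ball\<^sub>H n \<equiv> commutator_ball \<G> H n"

lemmas ball\<^sub>H_mult = commutator_ball_mult[OF H.subset]

lemma G_homeo:
  assumes "f \<in> G"
  shows "f \<in> extensional S" "homeomorphic_map X X f"
  using assms subgroup.subset[OF subgroup_G] by (auto simp: homeo_group_def)

lemma openin_preimage: "f \<in> G \<Longrightarrow> openin X U \<Longrightarrow> openin X {x \<in> S. f x \<in> U}"
  using openin_continuous_map_preimage[OF homeomorphic_imp_continuous_map[OF G_homeo(2)]] .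

lemma G_bij: "f \<in> G \<Longrightarrow> bij_betw f S S"
  using G_homeo(2) homeomorphic_imp_injective_map homeomorphic_imp_surjective_map
  by (fastforce simp: bij_betw_def)

lemma G_inj: "f \<in> G \<Longrightarrow> inj_on f S"
  using G_bij bij_betw_imp_inj_on by blast

lemma G_in: "f \<in> G \<Longrightarrow> x \<in> S \<Longrightarrow> f x \<in> S"
  using G_bij bij_betwE by blast

lemma G_eqI: "f \<in> G \<Longrightarrow> g \<in> G \<Longrightarrow> (\<And>x. x \<in> S \<Longrightarrow> f x = g x) \<Longrightarrow> f = g"
  using G_homeo(1) extensionalityI by blast

lemma mult_apply: "f \<in> G \<Longrightarrow> g \<in> G \<Longrightarrow> x \<in> S \<Longrightarrow> (f \<otimes>\<^bsub>\<G>\<^esub> g) x = f (g x)"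
  using G_homeo(1) G_bij by (simp add: \<G>_def homeo_group_def BijGroup_def Bij_def compose_def)

lemma one_apply: "x \<in> S \<Longrightarrow> \<one>\<^bsub>\<G>\<^esub> x = x"
  by (simp add: \<G>_def homeo_group_def BijGroup_def)

lemma mult_in [simp]: "f \<in> G \<Longrightarrow> g \<in> G \<Longrightarrow> f \<otimes>\<^bsub>\<G>\<^esub> g \<in> G"
  using m_closed by simp

lemma inv_in [simp]: "f \<in> G \<Longrightarrow> inv\<^bsub>\<G>\<^esub> f \<in> G"
  using inv_closed by simp

lemma one_in [simp]: "\<one>\<^bsub>\<G>\<^esub> \<in> G"
  using one_closed by simp

lemma commutator_in [simp]: "f \<in> G \<Longrightarrow> g \<in> G \<Longrightarrow> commutator \<G> f g \<in> G"
  using commutator_closed by simp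

lemmas G_closed = mult_in inv_in one_in

lemma inv_apply:
  assumes "f \<in> G" "x \<in> S"
  shows "(inv\<^bsub>\<G>\<^esub> f) (f x) = x" "f ((inv\<^bsub>\<G>\<^esub> f) x) = x"
proof -
  show "(inv\<^bsub>\<G>\<^esub> f) (f x) = x"
    using mult_apply[OF inv_in, of f f x] assms one_apply l_inv[of f] by simp
  show "f ((inv\<^bsub>\<G>\<^esub> f) x) = x"
    using mult_apply[OF _ inv_in, of f f x] assms one_apply r_inv[of f] by simp
qed

lemma H_subset: "H \<subseteq> G"
  using H.subset by simp

lemma closedin_supp: "closedin X (homeo_supp X f)"
  by (simp add: homeo_supp_def)

lemma moved_in_supp: "x \<in> S \<Longrightarrow> f x \<noteq> x \<Longrightarrow> x \<in> homeo_supp X f"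
  using closure_of_subset[of "{x \<in> S. f x \<noteq> x}" X] by (auto simp: homeo_supp_def)

lemma supp_subsetI:
  assumes "closedin X C" "\<And>x. x \<in> S \<Longrightarrow> f x \<noteq> x \<Longrightarrow> x \<in> C"
  shows "homeo_supp X f \<subseteq> C"
  unfolding homeo_supp_def using assms by (intro closure_of_minimal) auto

lemma supp_mult:
  assumes "f \<in> G" "g \<in> G"
  shows "homeo_supp X (f \<otimes>\<^bsub>\<G>\<^esub> g) \<subseteq> homeo_supp X f \<union> homeo_supp X g"
proof (rule supp_subsetI)
  show "x \<in> homeo_supp X f \<union> homeo_supp X g" if "x \<in> S" "(f \<otimes>\<^bsub>\<G>\<^esub> g) x \<noteq> x" for x
    using that assms by (metis UnI1 UnI2 moved_in_supp mult_apply)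
qed (intro closedin_Un closedin_supp)

lemma supp_inv: "f \<in> G \<Longrightarrow> homeo_supp X (inv\<^bsub>\<G>\<^esub> f) \<subseteq> homeo_supp X f"
  by (rule supp_subsetI[OF closedin_supp]) (metis inv_apply(1) moved_in_supp)

lemma supp_conj:
  assumes k: "k \<in> G" and f: "f \<in> G"
  shows "homeo_supp X (k \<otimes>\<^bsub>\<G>\<^esub> f \<otimes>\<^bsub>\<G>\<^esub> inv\<^bsub>\<G>\<^esub> k) \<subseteq> k ` homeo_supp X f"
proof (rule supp_subsetI)
  show "closedin X (k ` homeo_supp X f)"
    using homeomorphic_map_closedness_eq[OF G_homeo(2)[OF k]] closedin_supp by blast
  fix x assume x: "x \<in> S" "(k \<otimes>\<^bsub>\<G>\<^esub> f \<otimes>\<^bsub>\<G>\<^esub> inv\<^bsub>\<G>\<^esub> k) x \<noteq> x"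
  let ?y = "(inv\<^bsub>\<G>\<^esub> k) x"
  have y: "?y \<in> S" "k ?y = x" using x k by (auto simp: G_in inv_in inv_apply)
  have "(k \<otimes>\<^bsub>\<G>\<^esub> f \<otimes>\<^bsub>\<G>\<^esub> inv\<^bsub>\<G>\<^esub> k) x = k (f ?y)"
    using x(1) y(1) k f by (simp add: mult_apply G_closed)
  then have "f ?y \<noteq> ?y" using x(2) y(2) by auto
  then have "?y \<in> homeo_supp X f" by (rule moved_in_supp[OF y(1)])
  then have "k ?y \<in> k ` homeo_supp X f" by (rule imageI)
  then show "x \<in> k ` homeo_supp X f" by (simp only: y(2))
qed

text \<open>If \<open>f\<close> moves \<open>x\<close>, then by injectivity it also moves
  \<open>f x\<close>. Both points lie in the support of \<open>f\<close>, hence are fixed by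
  \<open>g\<close>, and the two products agree at \<open>x\<close>.\<close>

lemma disjoint_supp_commute:
  assumes f: "f \<in> G" and g: "g \<in> G" and disj: "homeo_supp X f \<inter> homeo_supp X g = {}"
  shows "f \<otimes>\<^bsub>\<G>\<^esub> g = g \<otimes>\<^bsub>\<G>\<^esub> f"
proof (rule G_eqI)
  fix x assume x: "x \<in> S"
  have *: "f' (g' x) = g' (f' x)" if "f' \<in> G" "g' \<in> G" "homeo_supp X f' \<inter> homeo_supp X g' = {}"
    "f' x \<noteq> x" for f' g'
  proof -
    have "f' (f' x) \<noteq> f' x"
      using that(1,4) x G_inj[of f'] G_in[of f' x] by (auto dest: inj_onD)
    then have "x \<in> homeo_supp X f'" "f' x \<in> homeo_supp X f'"
      using that x G_in by (auto intro: moved_in_supp)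
    then have "g' x = x" "g' (f' x) = f' x"
      using that(1,3) x G_in moved_in_supp by (metis disjoint_iff)+
    then show ?thesis by simp
  qed
  show "(f \<otimes>\<^bsub>\<G>\<^esub> g) x = (g \<otimes>\<^bsub>\<G>\<^esub> f) x"
  proof (cases "f x = x \<and> g x = x")
    case True
    then show ?thesis using x f g by (simp add: mult_apply)
  next
    case False
    then show ?thesis using *[OF f g disj] *[OF g f] disj x f g by (auto simp: mult_apply Int_commute)
  qed
qed (use f g in \<open>auto intro: mult_in\<close>)

lemma disjoint_supp_commutator:
  assumes "f \<in> G" "g \<in> G" "homeo_supp X f \<inter> homeo_supp X g = {}"
  shows "commutator \<G> f g = \<one>\<^bsub>\<G>\<^esub>"
  using assms by (intro commutator_eq_one disjoint_supp_commute) auto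

section \<open>Commutators modulo \<open>H\<close>, displaceable supports and small
  generators\<close>

lemma commutator_H:
  "h \<in> H \<Longrightarrow> k \<in> H \<Longrightarrow> commutator \<G> h k \<in> ball\<^sub>H 1"
  using commutator_in_commutator_ball[OF H.subset] by blast

lemma commutator_mem_H: "f \<in> G \<Longrightarrow> g \<in> G \<Longrightarrow> commutator \<G> f g \<in> H"
  by (rule commutator_in_derived)

lemma ball\<^sub>H_conj: "k \<in> G \<Longrightarrow> x \<in> ball\<^sub>H n \<Longrightarrow> k \<otimes>\<^bsub>\<G>\<^esub> x \<otimes>\<^bsub>\<G>\<^esub> inv\<^bsub>\<G>\<^esub> k \<in> ball\<^sub>H n"
  using commutator_ball_conj[OF H.normal_axioms] by simp

text \<open>Expanding the second entry leaves \<open>[h, k]\<close>, the other factor being trivial.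
  Thus \<open>h\<close> may be commuted with any element that agrees modulo \<open>H\<close> with
  one commuting with \<open>h\<close>, at the cost of one commutator of \<open>H\<close>.\<close>

lemma commutator_H_right:
  assumes h: "h \<in> H" and k: "k \<in> H" and x: "x \<in> G" and comm: "commutator \<G> h x = \<one>\<^bsub>\<G>\<^esub>"
  shows "commutator \<G> h (k \<otimes>\<^bsub>\<G>\<^esub> x) \<in> ball\<^sub>H 1"
  using assms commutator_H[OF h k] H_subset commutator_mult_right[of k x h]
  by (auto simp: subset_iff)

lemma commutator_H_left:
  assumes h: "h \<in> H" and k: "k \<in> H" and x: "x \<in> G" and comm: "commutator \<G> x h = \<one>\<^bsub>\<G>\<^esub>"
  shows "commutator \<G> (k \<otimes>\<^bsub>\<G>\<^esub> x) h \<in> ball\<^sub>H 1"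
  using assms commutator_H[OF k h] H_subset commutator_mult_left[of k x h]
  by (auto simp: subset_iff)

text \<open>Two displacing elements giving three pairwise disjoint copies are required because the
  two entries of a commutator are moved off to different copies.\<close>

definition displaceable :: "'a set \<Rightarrow> bool" where
  "displaceable W \<longleftrightarrow> openin X W \<and>
     (\<exists>a\<in>G. \<exists>b\<in>G. W \<inter> a ` W = {} \<and> W \<inter> b ` W = {} \<and> a ` W \<inter> b ` W = {})"

lemma displaceable_subset:
  assumes "displaceable W" "openin X V" "V \<subseteq> W"
  shows "displaceable V"
proof -
  obtain a b where ab: "a \<in> G" "b \<in> G" "W \<inter> a ` W = {}" "W \<inter> b ` W = {}" "a ` W \<inter> b ` W = {}"
    using assms(1) by (auto simp: displaceable_def)
  have "a ` V \<subseteq> a ` W" "b ` V \<subseteq> b ` W" using assms(3) by (simp_all add: image_mono)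
  then have "V \<inter> a ` V = {}" "V \<inter> b ` V = {}" "a ` V \<inter> b ` V = {}"
    using ab(3-5) assms(3) unfolding disjoint_iff subset_iff by meson+
  then show ?thesis using ab(1,2) assms(2) unfolding displaceable_def by metis
qed

text \<open>The conjugates by \<open>k\<close> of the displacing elements of \<open>W\<close>
  displace its image.\<close>

lemma displaceable_image:
  assumes W: "displaceable W" and k: "k \<in> G"
  shows "displaceable (k ` W)"
proof -
  obtain a b where ab: "openin X W" "a \<in> G" "b \<in> G" "W \<inter> a ` W = {}" "W \<inter> b ` W = {}" "a ` W \<inter> b ` W = {}"
    using W by (auto simp: displaceable_def)
  have WS: "W \<subseteq> S" using ab(1) openin_subset by blast
  let ?c = "\<lambda>a. k \<otimes>\<^bsub>\<G>\<^esub> a \<otimes>\<^bsub>\<G>\<^esub> inv\<^bsub>\<G>\<^esub> k"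
  have conj: "?c a ` (k ` W) = k ` (a ` W)" if "a \<in> G" for a
  proof -
    have "?c a (k x) = k (a x)" if "x \<in> W" for x
    proof -
      have "x \<in> S" using that WS by blast
      then show ?thesis using k \<open>a \<in> G\<close> by (simp add: mult_apply G_closed G_in inv_apply)
    qed
    then show ?thesis by (auto simp: image_iff)
  qed
  have disj: "k ` A \<inter> k ` B = {}" if "A \<subseteq> S" "B \<subseteq> S" "A \<inter> B = {}" for A B
    using that inj_on_image_Int[OF G_inj[OF k] that(1,2)] by simp
  have aS: "a ` W \<subseteq> S" "b ` W \<subseteq> S" using WS G_in ab by blast+
  have "openin X (k ` W)" using homeomorphic_map_openness_eq[OF G_homeo(2)[OF k]] ab(1) by blast
  moreover have "?c a \<in> G" "?c b \<in> G" using ab k by (auto intro: G_closed)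
  moreover have "k ` W \<inter> ?c a ` (k ` W) = {}" "k ` W \<inter> ?c b ` (k ` W) = {}"
    "?c a ` (k ` W) \<inter> ?c b ` (k ` W) = {}"
    unfolding conj[OF ab(2)] conj[OF ab(3)] using disj WS aS ab(4-6) by auto
  ultimately show ?thesis unfolding displaceable_def by blast
qed

text \<open>With \<open>a\<close> and \<open>b\<close> displacing the common support, \<open>[f, g] = [[f, b], [g, a]]\<close>.\<close>

lemma commutator_displaceable:
  assumes W: "displaceable W" and f: "f \<in> G" "homeo_supp X f \<subseteq> W" and g: "g \<in> G" "homeo_supp X g \<subseteq> W"
  shows "commutator \<G> f g \<in> ball\<^sub>H 1"
proof -
  obtain a b where ab: "a \<in> G" "b \<in> G" "W \<inter> a ` W = {}" "W \<inter> b ` W = {}" "a ` W \<inter> b ` W = {}"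
    using W by (auto simp: displaceable_def)
  let ?ga = "a \<otimes>\<^bsub>\<G>\<^esub> g \<otimes>\<^bsub>\<G>\<^esub> inv\<^bsub>\<G>\<^esub> a" and ?fb = "b \<otimes>\<^bsub>\<G>\<^esub> f \<otimes>\<^bsub>\<G>\<^esub> inv\<^bsub>\<G>\<^esub> b"
  let ?z = "commutator \<G> g a"
  have G: "?ga \<in> G" "?fb \<in> G" "?z \<in> G" using ab f g commutator_closed[of g a] by (auto intro: G_closed)
  have sga: "homeo_supp X ?ga \<subseteq> a ` W" using supp_conj[OF ab(1) g(1)] g(2) by blast
  have sfb: "homeo_supp X ?fb \<subseteq> b ` W" using supp_conj[OF ab(2) f(1)] f(2) by blast
  have geq: "g = ?z \<otimes>\<^bsub>\<G>\<^esub> ?ga" using eq_commutator_mult_conj[of a g] ab g by simp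
  have feq: "f = commutator \<G> f b \<otimes>\<^bsub>\<G>\<^esub> ?fb" using eq_commutator_mult_conj[of b f] ab f by simp
  have inv_ga: "inv\<^bsub>\<G>\<^esub> ?ga = a \<otimes>\<^bsub>\<G>\<^esub> inv\<^bsub>\<G>\<^esub> g \<otimes>\<^bsub>\<G>\<^esub> inv\<^bsub>\<G>\<^esub> a"
    using conj_inv[of a g] g ab by simp
  \<comment> \<open>In this form \<open>?z\<close> is seen to be supported in \<open>W\<close> and
    its image under \<open>a\<close>, away from the support of \<open>?fb\<close>. So of the two
    factors of \<open>f\<close> only \<open>[f, b]\<close>, which lies in \<open>H\<close>,
    contributes to the commutator with \<open>?z\<close>.\<close>
  have "?z = g \<otimes>\<^bsub>\<G>\<^esub> inv\<^bsub>\<G>\<^esub> ?ga"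
    unfolding inv_ga commutator_def using g ab by (simp add: m_assoc)
  then have "homeo_supp X ?z \<subseteq> W \<union> a ` W"
    using supp_mult[OF g(1) inv_in[OF G(1)]] supp_inv[OF G(1)] g(2) sga by auto
  then have "commutator \<G> ?fb ?z = \<one>\<^bsub>\<G>\<^esub>"
    using sfb ab(4,5) by (intro disjoint_supp_commutator G) blast
  then have z: "commutator \<G> f ?z \<in> ball\<^sub>H 1"
    using commutator_H_left[of ?z "commutator \<G> f b" ?fb] commutator_mem_H f g ab G feq by simp
  have "commutator \<G> f ?ga = \<one>\<^bsub>\<G>\<^esub>"
    using sga f ab(3) by (intro disjoint_supp_commutator G) blast+
  then have "commutator \<G> f (?z \<otimes>\<^bsub>\<G>\<^esub> ?ga) = commutator \<G> f ?z"
    using commutator_mult_right[of ?z ?ga f] G f by simp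
  then show ?thesis using z geq by simp
qed

text \<open>A condition on the coset of \<open>r\<close> modulo \<open>H\<close> only: it has
  representatives supported arbitrarily close to \<open>p\<close>, wherever \<open>r\<close> itself
  is supported.\<close>

definition germ_class :: "'a \<Rightarrow> ('a \<Rightarrow> 'a) \<Rightarrow> bool" where
  "germ_class p r \<longleftrightarrow> (\<forall>V. openin X V \<longrightarrow> p \<in> V \<longrightarrow>
     (\<exists>s\<in>G. \<exists>h\<in>H. r = h \<otimes>\<^bsub>\<G>\<^esub> s \<and> homeo_supp X s \<subseteq> V))"

lemma germ_classE:
  assumes "germ_class p r" "openin X V" "p \<in> V"
  obtains s h where "s \<in> G" "h \<in> H" "r = h \<otimes>\<^bsub>\<G>\<^esub> s" "homeo_supp X s \<subseteq> V"
  using assms unfolding germ_class_def by blast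

lemma germ_class_H_mult:
  assumes r: "germ_class p r" and k: "k \<in> H"
  shows "germ_class p (k \<otimes>\<^bsub>\<G>\<^esub> r)"
  unfolding germ_class_def
proof (intro allI impI)
  fix V assume "openin X V" "p \<in> V"
  then obtain s h where sh: "s \<in> G" "h \<in> H" "r = h \<otimes>\<^bsub>\<G>\<^esub> s" "homeo_supp X s \<subseteq> V"
    using r by (elim germ_classE)
  then have "k \<otimes>\<^bsub>\<G>\<^esub> r = (k \<otimes>\<^bsub>\<G>\<^esub> h) \<otimes>\<^bsub>\<G>\<^esub> s" using k H_subset by (auto simp: m_assoc subset_iff)
  then show "\<exists>s\<in>G. \<exists>h\<in>H. k \<otimes>\<^bsub>\<G>\<^esub> r = h \<otimes>\<^bsub>\<G>\<^esub> s \<and> homeo_supp X s \<subseteq> V"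
    using sh k H.m_closed by blast
qed

text \<open>Conjugating a representative by \<open>k\<close> carries its support from near
  \<open>p\<close> to near \<open>k p\<close> and changes it by a commutator, which lies in
  \<open>H\<close>.\<close>

lemma germ_class_translate:
  assumes r: "germ_class p r" and k: "k \<in> G" and p: "p \<in> S"
  shows "germ_class (k p) r"
  unfolding germ_class_def
proof (intro allI impI)
  fix V assume V: "openin X V" "k p \<in> V"
  have "openin X {x \<in> S. k x \<in> V}" by (rule openin_preimage[OF k V(1)])
  then obtain s h where sh: "s \<in> G" "h \<in> H" "r = h \<otimes>\<^bsub>\<G>\<^esub> s" "homeo_supp X s \<subseteq> {x \<in> S. k x \<in> V}"
    using r p V(2) by (auto elim: germ_classE)
  let ?s = "k \<otimes>\<^bsub>\<G>\<^esub> s \<otimes>\<^bsub>\<G>\<^esub> inv\<^bsub>\<G>\<^esub> k"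
  have sG: "?s \<in> G" using sh k by (auto intro: G_closed)
  have "s = commutator \<G> s k \<otimes>\<^bsub>\<G>\<^esub> ?s" using eq_commutator_mult_conj[of k s] k sh by simp
  then have "r = h \<otimes>\<^bsub>\<G>\<^esub> (commutator \<G> s k \<otimes>\<^bsub>\<G>\<^esub> ?s)" using sh(3) by simp
  then have "r = (h \<otimes>\<^bsub>\<G>\<^esub> commutator \<G> s k) \<otimes>\<^bsub>\<G>\<^esub> ?s"
    using m_assoc[of h "commutator \<G> s k" ?s] sh(1,2) k sG H_subset by auto
  moreover have "h \<otimes>\<^bsub>\<G>\<^esub> commutator \<G> s k \<in> H" using sh k commutator_mem_H H.m_closed by blast
  moreover have "homeo_supp X ?s \<subseteq> V" using supp_conj[OF k sh(1)] sh(4) by blast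
  ultimately show "\<exists>s\<in>G. \<exists>h\<in>H. r = h \<otimes>\<^bsub>\<G>\<^esub> s \<and> homeo_supp X s \<subseteq> V" using sG by blast
qed

text \<open>The class of \<open>x\<close> has a representative supported away from \<open>h\<close>:
  near \<open>p\<close> if \<open>p\<close> is outside the support of \<open>h\<close>, and
  otherwise near \<open>a p\<close>, which a displacing \<open>a\<close> moves out of
  \<open>W\<close>. This representative commutes with \<open>h\<close>, so only the factor of
  \<open>x\<close> in \<open>H\<close> matters, even if the supports of \<open>h\<close> and
  \<open>x\<close> overlap.\<close>

lemma commutator_small_H:
  assumes W: "displaceable W" and h: "h \<in> H" "homeo_supp X h \<subseteq> W"
    and x: "germ_class p x" and p: "p \<in> S"
  shows "commutator \<G> h x \<in> ball\<^sub>H 1" "commutator \<G> x h \<in> ball\<^sub>H 1"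
proof -
  obtain a where a: "a \<in> G" "W \<inter> a ` W = {}" using W by (auto simp: displaceable_def)
  have "\<exists>q. q \<in> S - homeo_supp X h \<and> germ_class q x"
  proof (cases "p \<in> homeo_supp X h")
    case True
    then have "a p \<notin> W" using h(2) a(2) by blast
    then show ?thesis using germ_class_translate[OF x a(1) p] h(2) G_in[OF a(1) p] by blast
  qed (use x p in blast)
  then obtain q where q: "q \<in> S - homeo_supp X h" "germ_class q x" by blast
  have "openin X (S - homeo_supp X h)" using closedin_supp by blast
  from germ_classE[OF q(2) this q(1)] obtain s k where sk: "s \<in> G" "k \<in> H" "x = k \<otimes>\<^bsub>\<G>\<^esub> s"
    "homeo_supp X s \<subseteq> S - homeo_supp X h" .
  have hG: "h \<in> G" using h H_subset by blast
  have "commutator \<G> h s = \<one>\<^bsub>\<G>\<^esub>" "commutator \<G> s h = \<one>\<^bsub>\<G>\<^esub>"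
    using sk(1,4) hG by (auto intro!: disjoint_supp_commutator)
  then show "commutator \<G> h x \<in> ball\<^sub>H 1" "commutator \<G> x h \<in> ball\<^sub>H 1"
    unfolding sk(3) using commutator_H_right[OF h(1) sk(2,1)] commutator_H_left[OF h(1) sk(2,1)] by blast+
qed

text \<open>The generators to which the uniform perfectness criterion is applied. \<open>W\<close>
  and \<open>p\<close> may vary with the element, which makes the set conjugation invariant.\<close>

definition small :: "('a \<Rightarrow> 'a) set" where
  "small = {r \<in> G. \<exists>W p. displaceable W \<and> p \<in> W \<and> homeo_supp X r \<subseteq> W \<and> germ_class p r}"

lemma small_conj:
  assumes k: "k \<in> G" and r: "r \<in> small"
  shows "k \<otimes>\<^bsub>\<G>\<^esub> r \<otimes>\<^bsub>\<G>\<^esub> inv\<^bsub>\<G>\<^esub> k \<in> small"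
proof -
  obtain W p where Wp: "r \<in> G" "displaceable W" "p \<in> W" "homeo_supp X r \<subseteq> W" "germ_class p r"
    using r by (auto simp: small_def)
  have p: "p \<in> S" using Wp(2,3) openin_subset by (auto simp: displaceable_def)
  have "germ_class (k p) (commutator \<G> k r \<otimes>\<^bsub>\<G>\<^esub> r)"
    using germ_class_H_mult[OF germ_class_translate[OF Wp(5) k p]] commutator_mem_H k Wp(1) by blast
  then have "germ_class (k p) (k \<otimes>\<^bsub>\<G>\<^esub> r \<otimes>\<^bsub>\<G>\<^esub> inv\<^bsub>\<G>\<^esub> k)"
    using conj_eq_commutator_mult[of k r] k Wp(1) by simp
  moreover have "homeo_supp X (k \<otimes>\<^bsub>\<G>\<^esub> r \<otimes>\<^bsub>\<G>\<^esub> inv\<^bsub>\<G>\<^esub> k) \<subseteq> k ` W"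
    using supp_conj[OF k Wp(1)] Wp(4) by blast
  moreover have "k \<otimes>\<^bsub>\<G>\<^esub> r \<otimes>\<^bsub>\<G>\<^esub> inv\<^bsub>\<G>\<^esub> k \<in> G" using k Wp by (auto intro: G_closed)
  ultimately show ?thesis using displaceable_image[OF Wp(2) k] Wp(3) unfolding small_def by blast
qed

text \<open>A representative \<open>s\<close> of the class of \<open>r\<close> can be chosen near
  \<open>p\<close>. The remaining factor is \<open>r\<close> times the inverse of \<open>s\<close>,
  so it is still supported in \<open>W\<close>; and \<open>s\<close>, differing from
  \<open>r\<close> by an element of \<open>H\<close>, keeps the class condition at
  \<open>p\<close>.\<close>

lemma small_shrink:
  assumes r: "r \<in> G" "homeo_supp X r \<subseteq> W" "germ_class p r" and W: "openin X W" and V: "openin X V" "p \<in> W" "p \<in> V"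
  obtains s h where "s \<in> G" "h \<in> H" "r = h \<otimes>\<^bsub>\<G>\<^esub> s" "homeo_supp X s \<subseteq> W \<inter> V" "homeo_supp X h \<subseteq> W"
    "germ_class p s"
proof -
  obtain s h where sh: "s \<in> G" "h \<in> H" "r = h \<otimes>\<^bsub>\<G>\<^esub> s" "homeo_supp X s \<subseteq> W \<inter> V"
    using germ_classE[OF r(3), of "W \<inter> V"] W V by blast
  have hG: "h \<in> G" using sh H_subset by blast
  have h: "h = r \<otimes>\<^bsub>\<G>\<^esub> inv\<^bsub>\<G>\<^esub> s" using sh hG by (simp add: m_assoc)
  have "homeo_supp X h \<subseteq> W"
    unfolding h using supp_mult[OF r(1) inv_in[OF sh(1)]] supp_inv[OF sh(1)] r(2) sh(4) by blast
  moreover have "s = inv\<^bsub>\<G>\<^esub> h \<otimes>\<^bsub>\<G>\<^esub> r" using sh hG by (simp add: inv_mult_cancel)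
  then have "germ_class p s" using germ_class_H_mult[OF r(3) H.m_inv_closed[OF sh(2)]] by simp
  ultimately show thesis using that sh by blast
qed

text \<open>Write \<open>x = h s\<close> and \<open>y = k t\<close> with \<open>s\<close> and
  \<open>t\<close> supported near the base points. The commutator expands into conjugates of
  \<open>[s, t]\<close> and \<open>[s, k]\<close> and the factor \<open>[h, y]\<close>, each a
  single commutator of \<open>H\<close>. For the last two, \<open>h\<close> and \<open>k\<close>
  have displaceable support; for the first, \<open>s\<close> and \<open>t\<close> have disjoint
  supports or lie in one displaceable set.\<close>

lemma commutator_small:
  assumes haus: "Hausdorff_space X" and x: "x \<in> small" and y: "y \<in> small"
  shows "commutator \<G> x y \<in> ball\<^sub>H 3"
proof -
  obtain W p where W: "x \<in> G" "displaceable W" "p \<in> W" "homeo_supp X x \<subseteq> W" "germ_class p x"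
    using x by (auto simp: small_def)
  obtain W' p' where W': "y \<in> G" "displaceable W'" "p' \<in> W'" "homeo_supp X y \<subseteq> W'" "germ_class p' y"
    using y by (auto simp: small_def)
  have op: "openin X W" "openin X W'" using W W' by (auto simp: displaceable_def)
  have pS: "p \<in> S" "p' \<in> S" using op W(3) W'(3) openin_subset by blast+
  obtain V V' where V: "openin X V" "openin X V'" "p \<in> V" "p' \<in> V'" "p = p' \<or> V \<inter> V' = {}"
  proof (cases "p = p'")
    case True
    then show ?thesis using that[of S S] pS by simp
  next
    case False
    then show ?thesis using that haus pS unfolding Hausdorff_space_def disjnt_def by metis
  qed
  obtain s h where s: "s \<in> G" "h \<in> H" "x = h \<otimes>\<^bsub>\<G>\<^esub> s" "homeo_supp X s \<subseteq> W \<inter> V" "homeo_supp X h \<subseteq> W"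
    "germ_class p s"
    by (rule small_shrink[OF W(1,4,5) op(1) V(1) W(3) V(3)])
  \<comment> \<open>When the base points coincide the supports of \<open>s\<close> and
    \<open>t\<close> cannot be separated; instead the neighbourhood is cut down to \<open>W\<close>,
    so that both lie in this displaceable set.\<close>
  obtain V'' where V'': "openin X V''" "p' \<in> V''" "V'' \<subseteq> V'" "p = p' \<Longrightarrow> V'' \<subseteq> W"
  proof (cases "p = p'")
    case True
    then show ?thesis using that[of "V' \<inter> W"] V W(3) op by auto
  qed (use that[of V'] V in auto)
  obtain t k where t: "t \<in> G" "k \<in> H" "y = k \<otimes>\<^bsub>\<G>\<^esub> t" "homeo_supp X t \<subseteq> W' \<inter> V''" "homeo_supp X k \<subseteq> W'"
    by (rule small_shrink[OF W'(1,4,5) op(2) V''(1) W'(3) V''(2)])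
  have G: "h \<in> G" "k \<in> G" using s t H_subset by auto
  have "commutator \<G> s t \<in> ball\<^sub>H 1"
  proof (cases "p = p'")
    case True
    then show ?thesis
      using commutator_displaceable[OF W(2) s(1) _ t(1)] s(4) t(4) V''(4) by blast
  next
    case False
    then have "homeo_supp X s \<inter> homeo_supp X t = {}" using s(4) t(4) V(5) V''(3) by blast
    then show ?thesis using disjoint_supp_commutator s(1) t(1) by simp
  qed
  then have 1: "k \<otimes>\<^bsub>\<G>\<^esub> commutator \<G> s t \<otimes>\<^bsub>\<G>\<^esub> inv\<^bsub>\<G>\<^esub> k \<in> ball\<^sub>H 1" by (rule ball\<^sub>H_conj[OF G(2)])
  have "commutator \<G> s k \<in> ball\<^sub>H 1"
    by (rule commutator_small_H(2)[OF W'(2) t(2,5) s(6) pS(1)])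
  from ball\<^sub>H_mult[OF this 1] have "commutator \<G> s y \<in> ball\<^sub>H (1 + 1)"
    unfolding t(3) using commutator_mult_right[of k t s] G s t by simp
  then have 2: "h \<otimes>\<^bsub>\<G>\<^esub> commutator \<G> s y \<otimes>\<^bsub>\<G>\<^esub> inv\<^bsub>\<G>\<^esub> h \<in> ball\<^sub>H (1 + 1)" by (rule ball\<^sub>H_conj[OF G(1)])
  have "commutator \<G> h y \<in> ball\<^sub>H 1"
    by (rule commutator_small_H(1)[OF W(2) s(2,5) W'(5) pS(2)])
  from ball\<^sub>H_mult[OF 2 this] have "commutator \<G> x y \<in> ball\<^sub>H (1 + 1 + 1)"
    unfolding s(3) using commutator_mult_left[of h s y] G s W' by simp
  then show ?thesis by (simp add: numeral_3_eq_3)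
qed

section \<open>Consequences of factorizability\<close>

lemma list_product_homeo_group: "list_product (homeo_group X) gs = list_product \<G> gs"
  by (simp add: list_product_def \<G>_def)

lemma factorizableE:
  assumes "factorizable X G" "open_cover X \<U>" "g \<in> G"
  obtains gs where "set gs \<subseteq> G" "g = list_product \<G> gs" "\<forall>h\<in>set gs. \<exists>U\<in>\<U>. homeo_supp X h \<subseteq> U"
  using assms unfolding factorizable_def list_product_homeo_group by meson

text \<open>Factor an element moving \<open>p\<close> along the cover by \<open>V\<close> and the
  complement of \<open>p\<close>. Some factor moves \<open>p\<close>; its support contains
  \<open>p\<close>, so it must lie in \<open>V\<close>.\<close>

lemma local_move:
  assumes haus: "Hausdorff_space X" and fact: "factorizable X G" and nf: "non_fixing X G"
    and V: "openin X V" "p \<in> V"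
  shows "\<exists>b\<in>G. homeo_supp X b \<subseteq> V \<and> b p \<noteq> p"
proof -
  have p: "p \<in> S" using V openin_subset by blast
  have "\<one>\<^bsub>\<G>\<^esub> p = p" by (rule one_apply[OF p])
  then have "p \<in> {g p | g. g \<in> G}" using one_in by (metis (mono_tags, lifting) mem_Collect_eq)
  then obtain a where a: "a \<in> G" "a p \<noteq> p" using nf p unfolding non_fixing_def by blast
  have "closedin X {p}" by (rule closedin_Hausdorff_singleton[OF haus p])
  then have "open_cover X {V, S - {p}}"
    using V openin_subset[OF V(1)] by (auto simp: open_cover_def)
  then obtain gs where gs: "set gs \<subseteq> G" "a = list_product \<G> gs"
    "\<forall>h\<in>set gs. \<exists>U\<in>{V, S - {p}}. homeo_supp X h \<subseteq> U"
    by (rule factorizableE[OF fact _ a(1)])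
  have "\<exists>h\<in>set gs. h p \<noteq> p"
  proof (rule ccontr)
    assume "\<not> ?thesis"
    then have "list_product \<G> gs p = p" using gs(1)
    proof (induction gs)
      case Nil
      then show ?case by (simp add: one_apply p)
    next
      case (Cons g gs)
      then show ?case using list_product_closed[of gs] p by (simp add: mult_apply)
    qed
    then show False using a gs by simp
  qed
  then obtain h where h: "h \<in> set gs" "h p \<noteq> p" by blast
  then have "p \<in> homeo_supp X h" using p moved_in_supp by blast
  then show ?thesis using gs h by blast
qed

text \<open>Choose \<open>a\<close> moving \<open>p\<close>, then \<open>b\<close> moving
  \<open>p\<close> with support avoiding \<open>a p\<close>. Since \<open>b\<close> fixes
  \<open>a p\<close>, injectivity makes \<open>p\<close>, \<open>a p\<close> and \<open>b p\<close>
  distinct, and small neighbourhoods of these three points can be kept apart.\<close>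

lemma displaceable_nhd:
  assumes haus: "Hausdorff_space X" and fact: "factorizable X G" and nf: "non_fixing X G" and p: "p \<in> S"
  shows "\<exists>W. displaceable W \<and> p \<in> W"
proof -
  obtain a where a: "a \<in> G" "a p \<noteq> p" using local_move[OF haus fact nf openin_topspace p] by blast
  have apS: "a p \<in> S" using G_in a p by blast
  have "closedin X {a p}" by (rule closedin_Hausdorff_singleton[OF haus apS])
  then have "openin X (S - {a p})" by (rule openin_diff[OF openin_topspace])
  moreover have "p \<in> S - {a p}" using a(2) p by simp
  ultimately obtain b where b: "b \<in> G" "homeo_supp X b \<subseteq> S - {a p}" "b p \<noteq> p"
    using local_move[OF haus fact nf] by meson
  have bpS: "b p \<in> S" using G_in b p by blast
  have "b (a p) = a p" using moved_in_supp[OF apS, of b] b(2) by blast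
  then have ab: "b p \<noteq> a p" using G_inj[OF b(1)] p apS a(2) by (metis inj_onD)
  have sep: "\<exists>U V. openin X U \<and> openin X V \<and> x \<in> U \<and> y \<in> V \<and> U \<inter> V = {}"
    if "x \<in> S" "y \<in> S" "x \<noteq> y" for x y
    using haus that unfolding Hausdorff_space_def disjnt_def by blast
  obtain A1 B1 where 1: "openin X A1" "openin X B1" "p \<in> A1" "a p \<in> B1" "A1 \<inter> B1 = {}"
    using sep[OF p apS] a(2) by auto
  obtain A2 C2 where 2: "openin X A2" "openin X C2" "p \<in> A2" "b p \<in> C2" "A2 \<inter> C2 = {}"
    using sep[OF p bpS] b(3) by auto
  obtain B3 C3 where 3: "openin X B3" "openin X C3" "a p \<in> B3" "b p \<in> C3" "B3 \<inter> C3 = {}"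
    using sep[OF apS bpS] ab by auto
  \<comment> \<open>Each of the three points has one neighbourhood separating it from each of the
    others; \<open>W\<close> and its images under \<open>a\<close> and \<open>b\<close> are made to
    lie in both neighbourhoods of the respective point.\<close>
  define W where "W = (A1 \<inter> A2) \<inter> {x \<in> S. a x \<in> B1 \<inter> B3} \<inter> {x \<in> S. b x \<in> C2 \<inter> C3}"
  have "openin X W" unfolding W_def
    by (intro openin_Int openin_preimage a b 1 2 3)
  moreover have "W \<inter> a ` W = {}" "W \<inter> b ` W = {}" "a ` W \<inter> b ` W = {}"
    using 1(5) 2(5) 3(5) unfolding W_def by auto
  ultimately have "displaceable W" using a(1) b(1) unfolding displaceable_def by blast
  moreover have "p \<in> W" using p 1 2 3 unfolding W_def by auto
  ultimately show ?thesis by blast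
qed

text \<open>Since \<open>G/H\<close> is finite, the classes represented by homeomorphisms supported in a neighbourhood
  of \<open>p\<close> stabilise when the neighbourhood shrinks.\<close>

lemma germ_nhd:
  assumes haus: "Hausdorff_space X" and fact: "factorizable X G" and nf: "non_fixing X G"
    and bdd: "bounded_group \<G>" and p: "p \<in> S"
  shows "\<exists>W. displaceable W \<and> p \<in> W \<and> (\<forall>r\<in>G. homeo_supp X r \<subseteq> W \<longrightarrow> germ_class p r)"
proof -
  define cls where "cls V = (\<lambda>r. H #>\<^bsub>\<G>\<^esub> r) ` {r \<in> G. homeo_supp X r \<subseteq> V}" for V
  have fin: "finite (cls V)" for V
  proof (rule finite_subset)
    show "cls V \<subseteq> carrier (\<G> Mod H)" by (auto simp: cls_def carrier_FactGroup)
    show "finite (carrier (\<G> Mod H))" using bounded_imp_finite_abelianization[OF bdd] by simp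
  qed
  let ?P = "\<lambda>V. displaceable V \<and> p \<in> V"
  \<comment> \<open>A displaceable neighbourhood with the fewest classes: its intersection with any
    open neighbourhood of \<open>p\<close> is again a candidate, so no class is lost by
    shrinking.\<close>
  obtain W where W: "?P W" "\<And>V. ?P V \<Longrightarrow> card (cls W) \<le> card (cls V)"
    using displaceable_nhd[OF haus fact nf p] ex_has_least_nat[of ?P _ "\<lambda>V. card (cls V)"] by metis
  have "germ_class p r" if r: "r \<in> G" "homeo_supp X r \<subseteq> W" for r
    unfolding germ_class_def
  proof (intro allI impI)
    fix V assume V: "openin X V" "p \<in> V"
    have "openin X W" using W(1) by (simp add: displaceable_def)
    then have "?P (W \<inter> V)" using W(1) V displaceable_subset[of W "W \<inter> V"] by auto
    then have "card (cls W) \<le> card (cls (W \<inter> V))" by (rule W(2))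
    moreover have "cls (W \<inter> V) \<subseteq> cls W" unfolding cls_def by blast
    ultimately have "cls (W \<inter> V) = cls W" using card_seteq[OF fin] by blast
    then have "H #>\<^bsub>\<G>\<^esub> r \<in> cls (W \<inter> V)" using r unfolding cls_def by blast
    then obtain s where s: "s \<in> G" "homeo_supp X s \<subseteq> W \<inter> V" "H #>\<^bsub>\<G>\<^esub> r = H #>\<^bsub>\<G>\<^esub> s"
      unfolding cls_def by blast
    have "r \<in> H #>\<^bsub>\<G>\<^esub> s" using rcos_self[of r H] r H.subgroup_axioms s(3) by simp
    then show "\<exists>s\<in>G. \<exists>h\<in>H. r = h \<otimes>\<^bsub>\<G>\<^esub> s \<and> homeo_supp X s \<subseteq> V"
      using s(1,2) unfolding r_coset_def by blast
  qed
  then show ?thesis using W(1) by blast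
qed

text \<open>The neighbourhoods from \<open>germ_nhd\<close> cover the space, and any element of
  \<open>G\<close> supported in one of them is small; factorizability for this cover gives the
  word.\<close>

lemma small_generates:
  assumes haus: "Hausdorff_space X" and fact: "factorizable X G" and nf: "non_fixing X G"
    and bdd: "bounded_group \<G>" and g: "g \<in> G"
  shows "\<exists>ys. set ys \<subseteq> small \<and> g = list_product \<G> ys"
proof -
  have "\<forall>p\<in>S. \<exists>W. displaceable W \<and> p \<in> W \<and> (\<forall>r\<in>G. homeo_supp X r \<subseteq> W \<longrightarrow> germ_class p r)"
    by (intro ballI germ_nhd[OF haus fact nf bdd])
  from bchoice[OF this] obtain W where "\<forall>p\<in>S. displaceable (W p) \<and> p \<in> W p \<and>
    (\<forall>r\<in>G. homeo_supp X r \<subseteq> W p \<longrightarrow> germ_class p r)" ..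
  then have W: "\<And>p. p \<in> S \<Longrightarrow> displaceable (W p)" "\<And>p. p \<in> S \<Longrightarrow> p \<in> W p"
    "\<And>p r. p \<in> S \<Longrightarrow> r \<in> G \<Longrightarrow> homeo_supp X r \<subseteq> W p \<Longrightarrow> germ_class p r"
    by simp_all
  have op: "openin X (W p)" if "p \<in> S" for p using W(1)[OF that] by (simp add: displaceable_def)
  have "\<Union>(W ` S) = S"
  proof
    show "\<Union>(W ` S) \<subseteq> S" by (intro UN_least openin_subset op)
    show "S \<subseteq> \<Union>(W ` S)" using W(2) by (intro subsetI UN_I)
  qed
  then have "open_cover X (W ` S)" using op by (auto simp: open_cover_def)
  then obtain gs where gs: "set gs \<subseteq> G" "g = list_product \<G> gs"
    "\<forall>h\<in>set gs. \<exists>U\<in>W ` S. homeo_supp X h \<subseteq> U"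
    by (rule factorizableE[OF fact _ g])
  have "set gs \<subseteq> small"
  proof
    fix h assume h: "h \<in> set gs"
    then obtain p where "p \<in> S" "homeo_supp X h \<subseteq> W p" using gs(3) by blast
    then show "h \<in> small" using W[of p] h gs(1) unfolding small_def by blast
  qed
  then show ?thesis using gs(2) by blast
qed

end

theorem corollary3p4:
  fixes X :: "'a topology" and G :: "('a \<Rightarrow> 'a) set"
  assumes "paracompact_space X"
    and "subgroup G (homeo_group X)"
    and "bounded_group ((homeo_group X)\<lparr>carrier := G\<rparr>)"
    and "factorizable X G"
    and "non_fixing X G"
  shows "uniformly_perfect ((homeo_group X)\<lparr>carrier := derived (homeo_group X) G\<rparr>)"
proof -
  interpret homeo_subgroup X G by (rule homeo_subgroup.intro) (rule assms(2))
  have haus: "Hausdorff_space X" using assms(1) by (simp add: paracompact_space_def)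
  have bdd: "bounded_group \<G>" using assms(3) by (simp add: \<G>_def)
  have "uniformly_perfect (\<G>\<lparr>carrier := derived \<G> (carrier \<G>)\<rparr>)"
  proof (rule bounded_imp_uniformly_perfect_derived[OF bdd, of small 3])
    show "small \<subseteq> carrier \<G>" by (auto simp: small_def)
    show "k \<otimes>\<^bsub>\<G>\<^esub> y \<otimes>\<^bsub>\<G>\<^esub> inv\<^bsub>\<G>\<^esub> k \<in> small" if "k \<in> carrier \<G>" "y \<in> small" for k y
      using small_conj that by simp
    show "\<exists>ys. set ys \<subseteq> small \<and> g = list_product \<G> ys" if "g \<in> carrier \<G>" for g
      using small_generates[OF haus assms(4,5) bdd] that by simp
    show "commutator \<G> x y \<in> commutator_ball \<G> (derived \<G> (carrier \<G>)) 3"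
      if "x \<in> small" "y \<in> small" for x y
      using commutator_small[OF haus that] by simp
  qed
  \<comment> \<open>The commutator subgroup is the same whether formed inside \<open>G\<close> or in
    the full homeomorphism group.\<close>
  moreover have "derived \<G> G = derived (homeo_group X) G"
    unfolding \<G>_def by (rule group.derived_consistent[OF group_homeo_group subset_refl assms(2)])
  ultimately show ?thesis by (simp add: \<G>_def)
qed

end
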